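(* Let $f$ be a valid feedback function (in which case $\sum_{j}f(j)^{-1}<+\infty$). Then for all fixed initial conditions $(x,y)\in\mathbb{N}^2$ of the two-bin balls-in-bins process with feedback function $f$ there is a constant $c>0$, depending only on $f$, $x$ and $y$, such that for every fixed $0<\alpha<1/2$, $$\mathbf{Pr}_{(x,y)}(\mathsf{LoserHasMoreThan}(\alpha,n))\sim c\,S_1(\lceil\alpha n\rceil,n-\lceil\alpha n\rceil)\quad\text{as }n\to+\infty,$$ where $S_1(n,m)=\sum_{j=n}^{m-1}\frac{1}{f(j)}$. Moreover, one can take $c$ to be the same constant for which $\mathbf{Pr}_{(x,y)}(L>n)\sim c\,\sum_{j=n}^{+\infty}\frac{1}{f(j)}$ as $n\to+\infty$, where $L$ is the number of balls in the losing bin.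
   Context: $\mathbb{N}=\{1,2,3,\dots\}$; $a_n\sim b_n$ means $a_n/b_n\to 1$. Two-bin balls-in-bins process with feedback function $f:\mathbb{N}\to(0,+\infty)$: the discrete-time Markov chain $\{(I_1(m),I_2(m))\}_{m\geq 0}$ on $\mathbb{N}^2$ in which at each time $m\ge 1$ exactly one ball is added, to bin $i_m\in\{1,2\}$ (so $I_{i_m}(m)=I_{i_m}(m-1)+1$ and the other coordinate is unchanged), where, conditionally on the past, $i_m=i$ with probability $f(I_i(m-1))/(f(I_1(m-1))+f(I_2(m-1)))$. $\mathbf{Pr}_{u}$ denotes probability when the initial state $(I_1(0),I_2(0))$ is $u\in\mathbb{N}^2$. When $\sum_j f(j)^{-1}<+\infty$, it is known that almost surely exactly one bin receives all but finitely many of the balls. The other bin is called the losing bin, and the losing number $L$ is the (almost surely finite) final number of balls in the losing bin, i.e. $L=\lim_{m\to\infty} I_i(m)$ for $i$ the losing bin. $\mathsf{LoserHasMoreThan}(\alpha,n)$ is the event that, at the time the total number of balls in the system reaches $n$, the number of balls in the losing bin is at least $\alpha n$. Valid feedback function: an increasing function $f:\mathbb{N}\to(0,+\infty)$ with $f(1)=1$ that can be extended to a $C^1$ function $g:[1,+\infty)\to(0,+\infty)$ such that, with $h(x)= x(\ln g)'(x)$ for $x\ge 1$: (1) $\liminf_{x\to+\infty}h(x)>1$; (2) $\lim_{x\to+\infty}x^{-1/4}h(x)=0$; (3) there exist $C>0$ and $x_0\geq 1$ such that for all $\epsilon\in(0,1)$ and all $x\ge x_0$, $\sup_{x\le t\le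 x^{1+\epsilon}}\left|\frac{h(t)}{h(x)}-1\right|\le C\epsilon$. *)

theory Defs
  imports "HOL-Probability.Probability"
begin

text \<open>
  A feedback function is represented by \<open>f :: nat \<Rightarrow> real\<close>; only its values at arguments
  \<open>n \<ge> 1\<close> are constrained or used.  ``Increasing'' is read in the weak sense.  At the
  endpoint \<open>x = 1\<close> derivatives are one-sided, relative to \<open>[1, \<infinity>)\<close>.
\<close>

definition log_deriv_ratio :: "(real \<Rightarrow> real) \<Rightarrow> real \<Rightarrow> real" where
  "log_deriv_ratio g x = x * vector_derivative (\<lambda>t. ln (g t)) (at x within {1..})"

definition C1_extension :: "(nat \<Rightarrow> real) \<Rightarrow> (real \<Rightarrow> real) \<Rightarrow> bool" where
  "C1_extension f g \<longleftrightarrow>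
     (\<forall>x\<ge>1. g x > 0) \<and>
     (\<forall>n\<ge>1. g (real n) = f n) \<and>
     (\<exists>g'. (\<forall>x\<ge>1. (g has_real_derivative g' x) (at x within {1..})) \<and> continuous_on {1..} g')"

definition valid_feedback :: "(nat \<Rightarrow> real) \<Rightarrow> bool" where
  "valid_feedback f \<longleftrightarrow>
     (\<forall>n\<ge>1. f n > 0) \<and> mono_on {1..} f \<and> f 1 = 1 \<and>
     (\<exists>g. C1_extension f g \<and>
        (let h = log_deriv_ratio g in
           Liminf at_top (\<lambda>x. ereal (h x)) > 1 \<and>
           ((\<lambda>x. x powr (- 1 / 4) * h x) \<longlongrightarrow> 0) at_top \<and>
           (\<exists>C>0. \<exists>x\<^sub>0\<ge>1. \<forall>\<epsilon>\<in>{0<..<1}. \<forall>x\<ge>x\<^sub>0.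
              (SUP t\<in>{x..x powr (1 + \<epsilon>)}. ereal \<bar>h t / h x - 1\<bar>) \<le> ereal (C * \<epsilon>))))"

datatype bin = Bin1 | Bin2

fun other_bin :: "bin \<Rightarrow> bin" where
  "other_bin Bin1 = Bin2"
| "other_bin Bin2 = Bin1"

fun load :: "bin \<Rightarrow> nat \<times> nat \<Rightarrow> nat" where
  "load Bin1 s = fst s"
| "load Bin2 s = snd s"

fun add_ball :: "bin \<Rightarrow> nat \<times> nat \<Rightarrow> nat \<times> nat" where
  "add_ball Bin1 (a, b) = (Suc a, b)"
| "add_ball Bin2 (a, b) = (a, Suc b)"

definition next_bin :: "(nat \<Rightarrow> real) \<Rightarrow> nat \<times> nat \<Rightarrow> bin pmf" where
  "next_bin f s = map_pmf (\<lambda>b. if b then Bin1 else Bin2)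
     (bernoulli_pmf (f (load Bin1 s) / (f (load Bin1 s) + f (load Bin2 s))))"

text \<open>
  Law of the state at time \<open>m\<close> given the path \<open>\<omega>\<close> up to time \<open>m - 1\<close>, started from \<open>u\<close>.
\<close>

definition bins_kernel ::
    "(nat \<Rightarrow> real) \<Rightarrow> nat \<times> nat \<Rightarrow> nat \<Rightarrow> (nat \<Rightarrow> nat \<times> nat) \<Rightarrow> (nat \<times> nat) measure" where
  "bins_kernel f u m \<omega> = measure_pmf
     (case m of 0 \<Rightarrow> return_pmf u
      | Suc k \<Rightarrow> map_pmf (\<lambda>i. add_ball i (\<omega> k)) (next_bin f (\<omega> k)))"

text \<open>
  The law of the chain on path space, given by the Ionescu-Tulcea theorem; the coordinate
  \<open>\<omega> m\<close> is the pair of loads at time \<open>m\<close>.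
\<close>

definition bins_process :: "(nat \<Rightarrow> real) \<Rightarrow> nat \<times> nat \<Rightarrow> (nat \<Rightarrow> nat \<times> nat) measure" where
  "bins_process f u =
     projective_family.lim UNIV
       (Ionescu_Tulcea.CI (bins_kernel f u) (\<lambda>_. count_space UNIV)) (\<lambda>_. count_space UNIV)"

lemma Ionescu_Tulcea_bins_kernel:
  "Ionescu_Tulcea (bins_kernel f u) (\<lambda>_. count_space UNIV)"
proof (rule Ionescu_Tulcea.intro)
  fix m :: nat
  show "bins_kernel f u m \<in> measurable (PiM {0..<m} (\<lambda>_. count_space UNIV))
          (subprob_algebra (count_space UNIV))"
  proof (cases m)
    case 0
    then show ?thesis
      by (simp add: bins_kernel_def[abs_def] measure_pmf_in_subprob_algebra)
  next
    case (Suc k)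
    have 1: "(\<lambda>\<omega>. \<omega> k) \<in> measurable (PiM {0..<m} (\<lambda>_. count_space UNIV)) (count_space (UNIV :: (nat \<times> nat) set))"
      using Suc by (intro measurable_component_singleton) auto
    have 2: "(\<lambda>s. measure_pmf (map_pmf (\<lambda>i. add_ball i s) (next_bin f s)))
        \<in> measurable (count_space UNIV) (subprob_algebra (count_space UNIV))"
      by (simp add: measure_pmf_in_subprob_algebra)
    show ?thesis
      using measurable_compose[OF 1 2] Suc by (simp add: bins_kernel_def[abs_def])
  qed
next
  fix m :: nat and \<omega> :: "nat \<Rightarrow> nat \<times> nat"
  show "prob_space (bins_kernel f u m \<omega>)"
    unfolding bins_kernel_def by (rule measure_pmf.prob_space_axioms)
qed

lemma sets_bins_process:
  "sets (bins_process f u) = sets (PiM UNIV (\<lambda>_. count_space UNIV))"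
proof -
  interpret Ionescu_Tulcea "bins_kernel f u" "\<lambda>_. count_space UNIV"
    by (rule Ionescu_Tulcea_bins_kernel)
  show ?thesis
    unfolding bins_process_def by (rule PF.sets_lim)
qed

lemma space_bins_process: "space (bins_process f u) = UNIV"
  using sets_eq_imp_space_eq[OF sets_bins_process[of f u]] by (simp add: space_PiM)

lemma emeasure_bins_process_prefix:
  "emeasure (bins_process f u) {\<omega>. \<forall>i<n. \<omega> i = v i} = (\<Prod>i<n. emeasure (bins_kernel f u i v) {v i})"
proof -
  interpret IT: Ionescu_Tulcea "bins_kernel f u" "\<lambda>_. count_space UNIV"
    by (rule Ionescu_Tulcea_bins_kernel)
  let ?M = "\<lambda>_::nat. count_space (UNIV :: (nat \<times> nat) set)"
  have sing: "{restrict v {0..<k}} \<in> sets (PiM {0..<k} ?M)" for k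
  proof -
    have "{restrict v {0..<k}} = PiE {0..<k} (\<lambda>i. {v i})"
      by (auto simp: PiE_iff intro!: extensionalityI[of _ "{0..<k}"])
    then show ?thesis
      by (auto intro!: sets_PiM_I_finite)
  qed
  have sp: "restrict v {0..<k} \<in> space (PiM {0..<k} ?M)" for k
    by (simp add: space_PiM)
  have kr: "bins_kernel f u k (restrict v {0..<k}) = bins_kernel f u k v" for k
    by (cases k) (auto simp: bins_kernel_def)
  have C: "emeasure (IT.C 0 n (\<lambda>_. undefined)) {restrict v {0..<n}}
      = (\<Prod>i<n. emeasure (bins_kernel f u i v) {v i})" for n
  proof (induction n)
    case 0
    have "restrict v {} = (\<lambda>_. undefined)"
      by auto
    then show ?case
      by (simp add: PiM_empty)
  next
    case (Suc n)
    let ?C = "IT.C 0 n (\<lambda>_. undefined)"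
    have un: "(\<lambda>_. undefined) \<in> space (PiM {0..<0} ?M)"
      by simp
    have eq: "emeasure (IT.eP n \<omega>) {restrict v {0..<Suc n}}
        = emeasure (bins_kernel f u n v) {v n} * indicator {restrict v {0..<n}} \<omega>"
      if \<omega>: "\<omega> \<in> space (PiM {0..<n} ?M)" for \<omega>
    proof -
      have "\<omega> \<in> extensional {0..<n}"
        using \<omega> by (simp add: space_PiM PiE_def)
      then have "fun_upd \<omega> n -` {restrict v {0..<Suc n}} \<inter> space (?M n)
          = (if \<omega> = restrict v {0..<n} then {v n} else {})"
        by (auto simp: fun_eq_iff extensional_def restrict_def less_Suc_eq split: if_splits)
      then show ?thesis
        using IT.emeasure_eP[OF \<omega> sing[of "Suc n"]] by (auto simp: kr)
    qed
    have "emeasure (IT.C 0 (Suc n) (\<lambda>_. undefined)) {restrict v {0..<Suc n}}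
        = (\<integral>\<^sup>+\<omega>. emeasure (IT.eP n \<omega>) {restrict v {0..<Suc n}} \<partial>?C)"
      using un IT.measurable_eP[of n] sing[of "Suc n"] IT.prob_space_C[OF un, of n]
      by (simp add: emeasure_bind[where N="PiM {0..<Suc n} ?M"] prob_space.not_empty
          measurable_cong_sets[OF IT.sets_C[OF un, of n] refl])
    also have "\<dots> = (\<integral>\<^sup>+\<omega>. emeasure (bins_kernel f u n v) {v n} * indicator {restrict v {0..<n}} \<omega> \<partial>?C)"
      using IT.space_C[OF un, of n] by (intro nn_integral_cong eq) simp
    also have "\<dots> = emeasure (bins_kernel f u n v) {v n} * emeasure ?C {restrict v {0..<n}}"
      using IT.sets_C[OF un, of n] sing[of n] by (subst nn_integral_cmult_indicator) auto
    finally show ?case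
      unfolding Suc prod.lessThan_Suc by (simp only: mult.commute)
  qed
  have "{\<omega>. \<forall>i<n. \<omega> i = v i} = IT.PF.emb UNIV {0..<n} {restrict v {0..<n}}"
    by (fastforce simp: prod_emb_def space_PiM restrict_def fun_eq_iff split: if_splits)
  then have "emeasure (bins_process f u) {\<omega>. \<forall>i<n. \<omega> i = v i} = emeasure (IT.CI {0..<n}) {restrict v {0..<n}}"
    unfolding bins_process_def using IT.lim[OF _ sing[of n]] by simp
  also have "\<dots> = emeasure (IT.C 0 n (\<lambda>_. undefined)) {restrict v {0..<n}}"
    using IT.emeasure_CI[of "{0..<n}" n "{restrict v {0..<n}}"] sing[of n]
    by (simp add: prod_emb_id sets.sets_into_space)
  finally show ?thesis
    using C by simp
qed

lemma prob_space_bins_process: "prob_space (bins_process f u)"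
  using emeasure_bins_process_prefix[of f u 0 undefined]
  by (intro prob_spaceI) (simp add: space_bins_process)

text \<open>
  A bin loses on a path if the other bin receives all but finitely many of the balls.  For
  summable \<open>1/f\<close> exactly one bin loses on almost every path, so off a null set the descriptions
  below are proper.
\<close>

definition loses :: "bin \<Rightarrow> (nat \<Rightarrow> nat \<times> nat) \<Rightarrow> bool" where
  "loses i \<omega> \<longleftrightarrow> (\<forall>\<^sub>F m in sequentially. \<omega> (Suc m) = add_ball (other_bin i) (\<omega> m))"

definition losing_bin :: "(nat \<Rightarrow> nat \<times> nat) \<Rightarrow> bin" where
  "losing_bin \<omega> = (THE i. loses i \<omega>)"

definition losing_number :: "(nat \<Rightarrow> nat \<times> nat) \<Rightarrow> nat" where
  "losing_number \<omega> = lim (\<lambda>m. load (losing_bin \<omega>) (\<omega> m))"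

definition loser_has_more_than :: "real \<Rightarrow> nat \<Rightarrow> (nat \<Rightarrow> nat \<times> nat) \<Rightarrow> bool" where
  "loser_has_more_than \<alpha> n \<omega> \<longleftrightarrow>
     (\<exists>m. load Bin1 (\<omega> m) + load Bin2 (\<omega> m) = n \<and> real (load (losing_bin \<omega>) (\<omega> m)) \<ge> \<alpha> * real n)"

definition S1 :: "(nat \<Rightarrow> real) \<Rightarrow> nat \<Rightarrow> nat \<Rightarrow> real" where
  "S1 f n m = (\<Sum>j=n..<m. 1 / f j)"

end

theory Submission
  imports Defs
begin

text \<open>
  Let \<open>G (a, b)\<close> be the probability that the chain visits the state \<open>(a, b)\<close>, and
  \<open>p (a, b) = G (a, b) f(a) f(b) / (f(a) + f(b))\<close>.  The recursion for \<open>G\<close> says that \<open>p (a, b)\<close> is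
  the average of \<open>p (a - 1, b)\<close> and \<open>p (a, b - 1)\<close> with weights \<open>f(a)\<close> and \<open>f(b)\<close>.  The rescaled
  differences \<open>f(a) (p (a - 1, b) - p (a, b))\<close> satisfy the same recursion, so the maximum principle
  bounds them; since \<open>\<Sum> 1/f\<close> converges, \<open>p\<close> tends to a limit \<open>l\<close> as both coordinates grow, and
  the minimum principle gives \<open>l > 0\<close>.  As \<open>G (k, n - k) = p (k, n - k) (1/f(k) + 1/f(n - k))\<close>, the
  probability that both bins hold at least \<open>a\<close> balls when the total is \<open>n\<close> is about
  \<open>2 l \<Sum>\<^sub>k 1/f(k)\<close>, summed over \<open>a \<le> k \<le> n - a\<close>.  Letting \<open>n\<close> grow with \<open>a\<close> fixed gives the law of
  the losing number, so \<open>c = 2 l\<close>.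

  The event in question differs from ``both bins hold at least \<open>\<alpha> n\<close> balls'' only if the bin with
  fewer than \<open>\<alpha> n\<close> balls overtakes the other one later.  With \<open>R(k) = \<Sum>\<^bsub>j \<ge> k\<^esub> 1/f(j)\<close>, the
  difference of the values of \<open>R\<close> at the two loads is a martingale, and Chebyshev's inequality,
  applied from the moment at which the trailing bin reaches \<open>\<alpha> n\<close>, makes overtaking negligible.
\<close>

section \<open>Averaging recursions\<close>

text \<open>An interior value is a convex combination of its two predecessors, which lie one
  antidiagonal closer to the origin. Induction on \<open>i + j\<close> therefore carries the bound
  \<open>B\<close> inward from the axes.\<close>

lemma average_max_principle:
  fixes q :: "nat \<Rightarrow> nat \<Rightarrow> real"
  assumes pos: "\<And>i. u i > 0" "\<And>j. v j > 0"
    and bd: "\<And>i. q i 0 \<le> B" "\<And>j. q 0 j \<le> B"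
    and av: "\<And>i j. (u (Suc i) + v (Suc j)) * q (Suc i) (Suc j)
               = u (Suc i) * q i (Suc j) + v (Suc j) * q (Suc i) j"
  shows "q i j \<le> B"
proof (induction "i + j" arbitrary: i j rule: less_induct)
  case less
  show ?case
  proof (cases i)
    case 0
    then show ?thesis using bd by simp
  next
    case i: (Suc i')
    show ?thesis
    proof (cases j)
      case 0
      then show ?thesis using bd by simp
    next
      case j: (Suc j')
      have "u i * q i' j \<le> u i * B" "v j * q i j' \<le> v j * B"
        using less[of i' j] less[of i j'] pos[of i] pos(2)[of j] by (auto simp: i j)
      then have "(u i + v j) * q i j \<le> (u i + v j) * B"
        using av[of i' j'] by (simp add: i j algebra_simps)
      then show ?thesis
        using pos(1)[of i] pos(2)[of j] by (simp add: add_pos_pos)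
    qed
  qed
qed

text \<open>The indices count the balls added to the initial loads. The equations on the axes are
  the inner equation with the missing predecessor given the value 0.\<close>

locale averaged =
  fixes u v :: "nat \<Rightarrow> real" and p :: "nat \<Rightarrow> nat \<Rightarrow> real"
  assumes u_pos: "u i > 0" and v_pos: "v j > 0"
    and summable_u: "summable (\<lambda>i. 1 / u i)" and summable_v: "summable (\<lambda>j. 1 / v j)"
    and origin: "p 0 0 > 0"
    and bottom: "(u (Suc i) + v 0) * p (Suc i) 0 = u (Suc i) * p i 0"
    and left: "(u 0 + v (Suc j)) * p 0 (Suc j) = v (Suc j) * p 0 j"
    and inner: "(u (Suc i) + v (Suc j)) * p (Suc i) (Suc j)
                 = u (Suc i) * p i (Suc j) + v (Suc j) * p (Suc i) j"
begin

lemma flip: "averaged v u (\<lambda>i j. p j i)"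
  by unfold_locales
    (use u_pos v_pos summable_u summable_v origin bottom left inner in \<open>auto simp: add.commute\<close>)

text \<open>Each step along the axis multiplies \<open>p\<close> by 1 / (1 + v 0 / u), which is at
  least exp (- v 0 / u). Summability of 1 / u then keeps the infinite product away from 0.\<close>

lemma bottom_ge: "p i 0 \<ge> p 0 0 * exp (- v 0 * (\<Sum>r<i. 1 / u (Suc r)))"
proof (induction i)
  case (Suc i)
  let ?E = "exp (- v 0 * (\<Sum>r<i. 1 / u (Suc r)))"
  have "1 + v 0 / u (Suc i) \<le> exp (v 0 / u (Suc i))"
    by (rule exp_ge_add_one_self)
  then have le: "exp (- (v 0 / u (Suc i))) \<le> u (Suc i) / (u (Suc i) + v 0)"
    using u_pos[of "Suc i"] v_pos[of 0]
    by (simp add: exp_minus divide_simps add_pos_pos mult.commute)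
  have "p 0 0 * exp (- v 0 * (\<Sum>r<Suc i. 1 / u (Suc r))) = (p 0 0 * ?E) * exp (- (v 0 / u (Suc i)))"
    by (simp add: algebra_simps flip: exp_add)
  also have "\<dots> \<le> p i 0 * (u (Suc i) / (u (Suc i) + v 0))"
    using Suc le origin by (intro mult_mono) (auto intro: order_trans[OF _ Suc])
  also have "\<dots> = p (Suc i) 0"
    using bottom[of i] u_pos[of "Suc i"] v_pos[of 0] by (simp add: field_simps)
  finally show ?case .
qed simp

lemma bottom_lower: "\<exists>k>0. \<forall>i. p i 0 \<ge> k"
proof (intro exI[of _ "p 0 0 * exp (- v 0 * (\<Sum>r. 1 / u (Suc r)))"] conjI allI)
  fix i
  have "summable (\<lambda>r. 1 / u (Suc r))"
    using summable_u by (subst summable_Suc_iff)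
  then have "(\<Sum>r<i. 1 / u (Suc r)) \<le> (\<Sum>r. 1 / u (Suc r))"
    using u_pos by (intro sum_le_suminf) (auto intro: less_imp_le)
  then have "exp (- v 0 * (\<Sum>r. 1 / u (Suc r))) \<le> exp (- v 0 * (\<Sum>r<i. 1 / u (Suc r)))"
    using v_pos[of 0] by simp
  then show "p 0 0 * exp (- v 0 * (\<Sum>r. 1 / u (Suc r))) \<le> p i 0"
    using bottom_ge[of i] origin by (meson mult_left_mono less_imp_le order_trans)
qed (use origin in simp)

lemma bottom_upper: "p i 0 \<le> p 0 0"
proof (induction i)
  case (Suc i)
  have "0 \<le> p i 0"
    using bottom_lower by (meson less_imp_le order_trans)
  then have "u (Suc i) * p i 0 \<le> (u (Suc i) + v 0) * p i 0"
    using v_pos[of 0] by (intro mult_right_mono) auto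
  then have "p (Suc i) 0 \<le> p i 0"
    using bottom[of i] u_pos[of "Suc i"] v_pos[of 0] by (metis add_pos_pos mult_le_cancel_left_pos)
  then show ?case using Suc by simp
qed simp

text \<open>The minimum principle, obtained from the maximum principle for \<open>- p\<close>. This
  uniform bound is what makes the limit of \<open>p\<close> positive.\<close>

lemma lower: "\<exists>k>0. \<forall>i j. p i j \<ge> k"
proof -
  obtain k1 where k1: "k1 > 0" "\<And>i. p i 0 \<ge> k1" using bottom_lower by blast
  obtain k2 where k2: "k2 > 0" "\<And>j. p 0 j \<ge> k2" using averaged.bottom_lower[OF flip] by blast
  have "- p i j \<le> - min k1 k2" for i j
  proof (rule average_max_principle[where q = "\<lambda>i j. - p i j" and u = u and v = v])
    show "- p i 0 \<le> - min k1 k2" "- p 0 i \<le> - min k1 k2" for i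
      using k1(2)[of i] k2(2)[of i] by auto
    show "(u (Suc i) + v (Suc j)) * - p (Suc i) (Suc j) = u (Suc i) * - p i (Suc j) + v (Suc j) * - p (Suc i) j" for i j
      using inner[of i j] by simp
  qed (fact u_pos v_pos)+
  then show ?thesis using k1(1) k2(1) by (intro exI[of _ "min k1 k2"]) auto
qed

lemma upper: "p i j \<le> p 0 0"
proof (rule average_max_principle[where q = p and u = u and v = v])
  show "p 0 j \<le> p 0 0" for j
    using averaged.bottom_upper[OF flip] .
qed (fact u_pos v_pos bottom_upper inner)+

lemma nonneg: "p i j \<ge> 0"
  using lower by (meson less_imp_le order_trans)

text \<open>The differences of \<open>p\<close>, rescaled by the weights, satisfy the same averaging
  equation; so the maximum principle bounds them too.\<close>

definition d :: "nat \<Rightarrow> nat \<Rightarrow> real" where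
  "d i j = (case i of Suc i' \<Rightarrow> u i * (p i' j - p i j)
                    | 0 \<Rightarrow> (if j = 0 then 0 else - u 0 * p 0 j))"

lemma d_Suc1: "d (Suc i) j = u (Suc i) * (p i j - p (Suc i) j)"
  by (simp add: d_def)

text \<open>The averaging equation says precisely that u times the decrease of \<open>p\<close> in
  the first direction equals v times its increase in the second, so \<open>d\<close> can be read off
  in either direction.\<close>

lemma d_Suc2: "d i (Suc j) = v (Suc j) * (p i (Suc j) - p i j)"
  using left[of j] inner[of _ j] by (cases i) (auto simp: d_def algebra_simps)

text \<open>Expand the u-share of the left side in the second direction and the v-share in the
  first. The corner value of \<open>p\<close> cancels on either side, and both sides equal u v times
  \<open>p i (Suc j) - p (Suc i) j\<close>.\<close>

lemma d_average:
  "(u (Suc i) + v (Suc j)) * d (Suc i) (Suc j) = u (Suc i) * d i (Suc j) + v (Suc j) * d (Suc i) j"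
proof -
  have "(u (Suc i) + v (Suc j)) * d (Suc i) (Suc j) =
      u (Suc i) * (v (Suc j) * (p (Suc i) (Suc j) - p (Suc i) j))
      + v (Suc j) * (u (Suc i) * (p i (Suc j) - p (Suc i) (Suc j)))"
    by (simp add: distrib_right flip: d_Suc1 d_Suc2)
  then show ?thesis
    by (simp add: d_Suc2[of i] d_Suc1[of _ j] algebra_simps)
qed

text \<open>Away from the origin the axis equations turn \<open>d\<close> into
  \<open>v 0 * p i 0\<close> and \<open>- u 0 * p 0 j\<close>, which \<open>upper\<close> controls.
  The maximum principle for \<open>d\<close> and for \<open>- d\<close> extends the bound to the
  quadrant.\<close>

lemma d_bound: "\<bar>d i j\<bar> \<le> (u 0 + v 0) * p 0 0"
proof -
  have b1: "\<bar>d i 0\<bar> \<le> (u 0 + v 0) * p 0 0" for i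
  proof (cases i)
    case (Suc i')
    have "d i 0 = v 0 * p i 0"
      using bottom[of i'] by (simp add: Suc d_Suc1 algebra_simps)
    also have "\<bar>\<dots>\<bar> \<le> v 0 * p 0 0"
      using nonneg[of i 0] upper[of i 0] v_pos[of 0] by (simp add: abs_mult)
    finally show ?thesis
      using u_pos[of 0] origin by (simp add: distrib_right)
        (meson add_increasing less_imp_le mult_pos_pos)
  qed (use u_pos[of 0] v_pos[of 0] origin in \<open>simp add: d_def\<close>)
  have b2: "\<bar>d 0 j\<bar> \<le> (u 0 + v 0) * p 0 0" for j
  proof -
    have "\<bar>d 0 j\<bar> \<le> u 0 * p 0 j"
      using nonneg[of 0 j] u_pos[of 0] origin by (simp add: d_def abs_mult)
    also have "\<dots> \<le> (u 0 + v 0) * p 0 0"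
      using upper[of 0 j] u_pos[of 0] v_pos[of 0] nonneg[of 0 j] by (intro mult_mono) auto
    finally show ?thesis .
  qed
  have "d i j \<le> (u 0 + v 0) * p 0 0"
    by (rule average_max_principle[where q = d and u = u and v = v])
      (use b1 b2 u_pos v_pos d_average in \<open>auto simp: abs_le_iff\<close>)
  moreover have "- d i j \<le> (u 0 + v 0) * p 0 0"
  proof (rule average_max_principle[where q = "\<lambda>i j. - d i j" and u = u and v = v])
    show "(u (Suc i) + v (Suc j)) * - d (Suc i) (Suc j) = u (Suc i) * - d i (Suc j) + v (Suc j) * - d (Suc i) j" for i j
      using d_average[of i j] by simp
  qed (use b1 b2 u_pos v_pos in \<open>auto simp: abs_le_iff\<close>)
  ultimately show ?thesis by simp
qed

lemma step1: "\<bar>p (n + k) j - p n j\<bar> \<le> (u 0 + v 0) * p 0 0 * (\<Sum>r. 1 / u (r + n))"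
proof -
  let ?B = "(u 0 + v 0) * p 0 0"
  have one: "\<bar>p (Suc i) j - p i j\<bar> \<le> ?B * (1 / u (Suc i))" for i
    using d_bound[of "Suc i" j] u_pos[of "Suc i"]
    by (simp add: d_Suc1 abs_mult divide_simps abs_minus_commute mult.commute)
  \<comment> \<open>The k increments cost the terms r = 1, ..., k. The term r = 0 is added only so
    that the bound becomes a tail of the series starting at n.\<close>
  have "\<bar>p (n + k) j - p n j\<bar> \<le> ?B * (\<Sum>r<Suc k. 1 / u (r + n))"
  proof (induction k)
    case 0
    show ?case using u_pos[of n] u_pos[of 0] v_pos[of 0] origin by simp
  next
    case (Suc k)
    show ?case using Suc one[of "n + k"]
      by (simp add: distrib_left add.commute)
  qed
  also have "\<dots> \<le> ?B * (\<Sum>r. 1 / u (r + n))"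
    using u_pos v_pos origin summable_ignore_initial_segment[OF summable_u, of n]
    by (intro mult_left_mono sum_le_suminf) (auto intro!: less_imp_le[of 0] mult_pos_pos add_pos_pos)
  finally show ?thesis .
qed

text \<open>Going from (n, n) to (i, j) along one coordinate and then the other changes
  \<open>p\<close> by at most a sum of two series tails. Hence \<open>p\<close> is uniformly Cauchy
  on far quadrants, and the diagonal limit is the limit along the whole quadrant.\<close>

lemma limit: "\<exists>l>0. \<forall>e>0. \<exists>n. \<forall>i\<ge>n. \<forall>j\<ge>n. \<bar>p i j - l\<bar> < e"
proof -
  define D where "D n = (u 0 + v 0) * p 0 0 * ((\<Sum>r. 1 / u (r + n)) + (\<Sum>r. 1 / v (r + n)))" for n
  have "D \<longlonglongrightarrow> (u 0 + v 0) * p 0 0 * (0 + 0)"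
    unfolding D_def
    by (intro tendsto_intros suminf_exist_split2 summable_u summable_v)
  then have D0: "D \<longlonglongrightarrow> 0" by simp
  have near: "\<bar>p i j - p n n\<bar> \<le> D n" if "i \<ge> n" "j \<ge> n" for i j n
  proof -
    have k: "i = n + (i - n)" and m: "j = n + (j - n)"
      using that by auto
    have "\<bar>p i j - p n j\<bar> \<le> (u 0 + v 0) * p 0 0 * (\<Sum>r. 1 / u (r + n))"
      using step1[of n "i - n" j] k by simp
    moreover have "\<bar>p n j - p n n\<bar> \<le> (u 0 + v 0) * p 0 0 * (\<Sum>r. 1 / v (r + n))"
      using averaged.step1[OF flip, of n n "j - n"] m by (simp add: add.commute)
    ultimately show ?thesis
      by (simp add: D_def distrib_left)
  qed
  have "Cauchy (\<lambda>n. p n n)"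
  proof (rule CauchyI')
    fix e :: real assume "e > 0"
    then obtain N where N: "\<And>n. n \<ge> N \<Longrightarrow> \<bar>D n\<bar> < e"
      using LIMSEQ_D[OF D0] by auto
    have "dist (p m m) (p n n) < e" if "N \<le> m" "m < n" for m n
      using near[of m n n] N[of m] that by (simp add: dist_real_def abs_minus_commute)
    then show "\<exists>M. \<forall>m\<ge>M. \<forall>n>m. dist (p m m) (p n n) < e"
      by blast
  qed
  then obtain l where l: "(\<lambda>n. p n n) \<longlonglongrightarrow> l"
    using Cauchy_convergent_iff convergent_def by blast
  have nl: "\<bar>l - p n n\<bar> \<le> D n" for n
  proof (rule LIMSEQ_le_const2)
    show "(\<lambda>m. \<bar>p m m - p n n\<bar>) \<longlonglongrightarrow> \<bar>l - p n n\<bar>"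
      by (intro tendsto_intros l)
  qed (use near in blast)
  obtain k where k: "k > 0" "\<And>i j. p i j \<ge> k" using lower by blast
  have "l \<ge> k"
    using LIMSEQ_le_const[OF l] k(2) by blast
  moreover have "\<exists>n. \<forall>i\<ge>n. \<forall>j\<ge>n. \<bar>p i j - l\<bar> < e" if "e > 0" for e
  proof -
    obtain n where "\<bar>D n\<bar> < e / 2"
      using LIMSEQ_D[OF D0, of "e / 2"] \<open>e > 0\<close> by auto
    moreover have "\<bar>p i j - l\<bar> \<le> 2 * D n" if "i \<ge> n" "j \<ge> n" for i j
      using near[OF that] nl[of n] by linarith
    ultimately show ?thesis
      by (intro exI[of _ n] allI impI) fastforce
  qed
  ultimately show ?thesis
    using k(1) by (intro exI[of _ l]) auto
qed

end

section \<open>Growth of valid feedback functions\<close>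

text \<open>The bridge from hypotheses on h to the consecutive ratios of f: the mean value theorem
  for ln g on [j, j + 1].\<close>

lemma C1_extension_log_mvt:
  assumes "C1_extension f g" "j \<ge> 1"
  shows "\<exists>\<xi>. real j < \<xi> \<and> \<xi> < real j + 1 \<and> ln (f (Suc j)) - ln (f j) = log_deriv_ratio g \<xi> / \<xi>"
proof -
  obtain g' where pos: "\<And>x. x \<ge> 1 \<Longrightarrow> g x > 0" and gf: "\<And>n. n \<ge> 1 \<Longrightarrow> g (real n) = f n"
    and g': "\<And>x. x \<ge> 1 \<Longrightarrow> (g has_real_derivative g' x) (at x within {1..})"
    using assms(1) unfolding C1_extension_def by blast
  have der: "((\<lambda>t. ln (g t)) has_real_derivative g' x / g x) (at x within {1..})" if "x \<ge> 1" for x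
    using DERIV_ln_divide[OF pos[OF that]] g'[OF that]
    by (auto intro!: derivative_eq_intros simp: pos that)
  have h: "log_deriv_ratio g x = x * (g' x / g x)" if "x \<ge> 1" for x
  proof -
    \<comment> \<open>A derivative within a set is unique only at limit points of the set. The
      interval to the right of x settles this at the endpoint 1 as well.\<close>
    have "at x within {x..x + 1} \<noteq> bot"
      by (simp add: trivial_limit_within islimpt_Icc)
    moreover have "at x within {x..x + 1} \<le> at x within {1..}"
      using that by (intro at_le) auto
    ultimately have "at x within {1..} \<noteq> bot"
      by (metis bot.extremum_uniqueI)
    then show ?thesis
      using der[OF that] by (simp add: log_deriv_ratio_def has_real_derivative_iff_has_vector_derivative
          vector_derivative_within)
  qed
  have "\<exists>\<xi>\<in>{real j<..<real j + 1}. ln (g (real j + 1)) - ln (g (real j)) = (real j + 1 - real j) * (g' \<xi> / g \<xi>)"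
  proof -
    have "((\<lambda>t. ln (g t)) has_derivative (*) (g' x / g x)) (at x within {real j..real j + 1})"
      if "real j \<le> x" "x \<le> real j + 1" for x
      using has_field_derivative_imp_has_derivative[OF der[of x]] that assms(2)
      by (auto intro: has_derivative_subset)
    from mvt_simple[OF _ this] show ?thesis by (auto simp: mult.commute)
  qed
  then obtain \<xi> where "real j < \<xi>" "\<xi> < real j + 1"
      "ln (g (real (Suc j))) - ln (g (real j)) = g' \<xi> / g \<xi>"
    by (auto simp: add.commute)
  then show ?thesis
    using h[of \<xi>] gf[of j] gf[of "Suc j"] assms(2) by (intro exI[of _ \<xi>]) auto
qed

text \<open>Take r with 1 < r < liminf h. The mean value theorem gives ln (f (j + 1) / f j) \<ge> r
  / (j + 1) for large j, hence a ratio of at least 1 + r / (j + 1). With \<eta> = r - 1 this is a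
  Raabe-type condition for the convergence of the series of 1 / f.\<close>

lemma valid_feedback_growth:
  assumes "valid_feedback f"
  obtains \<eta> where "\<eta> > 0"
    "\<forall>\<^sub>F j in sequentially. f (Suc j) * (real j + 1) \<ge> f j * (real j + 2 + \<eta>)"
proof -
  obtain g where fpos: "\<And>n. n \<ge> 1 \<Longrightarrow> f n > 0" and g: "C1_extension f g"
    and li: "Liminf at_top (\<lambda>x. ereal (log_deriv_ratio g x)) > 1"
    using assms unfolding valid_feedback_def Let_def by blast
  obtain c where c: "1 < c" "c < Liminf at_top (\<lambda>x. ereal (log_deriv_ratio g x))"
    using li dense by blast
  have "\<bar>c\<bar> \<noteq> \<infinity>" using c by auto
  then obtain r where r: "c = ereal r" by auto
  have "\<forall>\<^sub>F x in at_top. c < ereal (log_deriv_ratio g x)"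
    by (rule less_LiminfD[OF c(2)])
  then obtain X where X: "\<And>x. x \<ge> X \<Longrightarrow> r < log_deriv_ratio g x"
    unfolding eventually_at_top_linorder r by auto
  show ?thesis
  proof (rule that[of "r - 1"])
    show "r - 1 > 0" using c(1) r by (simp add: one_ereal_def)
    show "\<forall>\<^sub>F j in sequentially. f (Suc j) * (real j + 1) \<ge> f j * (real j + 2 + (r - 1))"
      using eventually_ge_at_top[of "max 1 (nat \<lceil>X\<rceil>)"]
    proof eventually_elim
      case (elim j)
      have j: "j \<ge> 1" "real j \<ge> X" using elim by linarith+
      obtain \<xi> where xi: "real j < \<xi>" "\<xi> < real j + 1"
        and eq: "ln (f (Suc j)) - ln (f j) = log_deriv_ratio g \<xi> / \<xi>"
        using C1_extension_log_mvt[OF g j(1)] by blast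
      have "r / (real j + 1) \<le> log_deriv_ratio g \<xi> / \<xi>"
        using X[of \<xi>] xi j \<open>r - 1 > 0\<close> by (intro frac_le) auto
      then have "exp (r / (real j + 1)) \<le> exp (ln (f (Suc j)) - ln (f j))"
        using eq by simp
      also have "\<dots> = f (Suc j) / f j"
        using fpos[of j] fpos[of "Suc j"] j by (simp add: exp_diff)
      finally have "1 + r / (real j + 1) \<le> f (Suc j) / f j"
        using exp_ge_add_one_self[of "r / (real j + 1)"] by linarith
      then show ?case
        using fpos[of j] j by (simp add: field_simps)
    qed
  qed
qed

text \<open>Since 1 / x \<le> x powr (- 1 / 4) for x \<ge> 1, the second condition on h forces h(x)
  / x to 0, and by the mean value theorem so does the increment of ln f.\<close>

lemma valid_feedback_ratio:
  assumes "valid_feedback f"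
  shows "(\<lambda>j. f (Suc j) / f j) \<longlonglongrightarrow> 1"
proof -
  obtain g where fpos: "\<And>n. n \<ge> 1 \<Longrightarrow> f n > 0" and g: "C1_extension f g"
    and lim: "((\<lambda>x. x powr (- 1 / 4) * log_deriv_ratio g x) \<longlongrightarrow> 0) at_top"
    using assms unfolding valid_feedback_def Let_def by blast
  have "((\<lambda>x. log_deriv_ratio g x / x) \<longlongrightarrow> 0) at_top"
  proof (rule Lim_null_comparison[OF _ tendsto_rabs_zero[OF lim]])
    show "\<forall>\<^sub>F x in at_top. norm (log_deriv_ratio g x / x) \<le> \<bar>x powr (- 1 / 4) * log_deriv_ratio g x\<bar>"
      using eventually_ge_at_top[of 1]
    proof eventually_elim
      case (elim x)
      have "inverse x = x powr (- 1)" using elim by (simp add: powr_minus)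
      also have "\<dots> \<le> x powr (- 1 / 4)" using elim by (intro powr_mono) auto
      finally have "inverse x * \<bar>log_deriv_ratio g x\<bar> \<le> x powr (- 1 / 4) * \<bar>log_deriv_ratio g x\<bar>"
        by (rule mult_right_mono) simp
      moreover have "norm (log_deriv_ratio g x / x) = inverse x * \<bar>log_deriv_ratio g x\<bar>"
        using elim by (simp add: abs_mult divide_inverse)
      ultimately show ?case by (simp add: abs_mult)
    qed
  qed
  then have X: "\<exists>X. \<forall>x\<ge>X. \<bar>log_deriv_ratio g x / x\<bar> < e" if "e > 0" for e
    using that tendstoD[of "\<lambda>x. log_deriv_ratio g x / x" 0 at_top e]
    by (simp add: eventually_at_top_linorder)
  have "(\<lambda>j. ln (f (Suc j)) - ln (f j)) \<longlonglongrightarrow> 0"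
  proof (rule LIMSEQ_I)
    fix e :: real assume "e > 0"
    then obtain X where X: "\<And>x. x \<ge> X \<Longrightarrow> \<bar>log_deriv_ratio g x / x\<bar> < e" using X by blast
    have "\<bar>ln (f (Suc j)) - ln (f j)\<bar> < e" if "j \<ge> max 1 (nat \<lceil>X\<rceil>)" for j
    proof -
      have "j \<ge> 1" "real j \<ge> X" using that by linarith+
      then obtain \<xi> where "real j < \<xi>" "ln (f (Suc j)) - ln (f j) = log_deriv_ratio g \<xi> / \<xi>"
        using C1_extension_log_mvt[OF g, of j] by blast
      then show ?thesis
        using X[of \<xi>] \<open>real j \<ge> X\<close> by simp
    qed
    then show "\<exists>no. \<forall>n\<ge>no. norm (ln (f (Suc n)) - ln (f n) - 0) < e"
      unfolding real_norm_def diff_zero by blast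
  qed
  then have "(\<lambda>j. exp (ln (f (Suc j)) - ln (f j))) \<longlonglongrightarrow> exp 0"
    by (rule tendsto_exp)
  moreover have "\<forall>\<^sub>F j in sequentially. exp (ln (f (Suc j)) - ln (f j)) = f (Suc j) / f j"
    using eventually_ge_at_top[of 1] by eventually_elim (simp add: exp_diff fpos)
  ultimately show ?thesis
    by (simp add: Lim_transform_eventually)
qed

text \<open>The hypotheses on a feedback function enter the proof only through its consecutive
  ratios.\<close>

locale tame_feedback =
  fixes f :: "nat \<Rightarrow> real" and \<eta> :: real
  assumes f_pos: "n \<ge> 1 \<Longrightarrow> f n > 0"
    and f_mono: "1 \<le> m \<Longrightarrow> m \<le> n \<Longrightarrow> f m \<le> f n"
    and eta_pos: "\<eta> > 0"
    and growth: "\<forall>\<^sub>F j in sequentially. f (Suc j) * (real j + 1) \<ge> f j * (real j + 2 + \<eta>)"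
    and ratio: "(\<lambda>j. f (Suc j) / f j) \<longlonglongrightarrow> 1"
begin

text \<open>The discrete form of (x / g)' = (1 - h) / g: since h stays above 1, the decrease of j /
  f j is at least a fixed multiple of 1 / f j.\<close>

lemma telescoping_bound:
  "\<exists>C>0. \<forall>\<^sub>F j in sequentially. 1 / f j \<le> C * (real j / f j - real (Suc j) / f (Suc j))"
proof (intro exI[of _ "2 / \<eta>"] conjI)
  \<comment> \<open>Multiplied by \<eta>, this threshold is exactly the condition for (\<eta> j - 1)
    / (j + 2 + \<eta>) \<ge> \<eta> / 2.\<close>
  have "\<forall>\<^sub>F j in sequentially. real j \<ge> 2 / \<eta> + 2 + \<eta>"
    using eventually_ge_at_top[of "nat \<lceil>2 / \<eta> + 2 + \<eta>\<rceil>"] by eventually_elim linarith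
  with growth eventually_ge_at_top[of 1]
  show "\<forall>\<^sub>F j in sequentially. 1 / f j \<le> 2 / \<eta> * (real j / f j - real (Suc j) / f (Suc j))"
  proof eventually_elim
    case (elim j)
    have fj: "f j > 0" and fSj: "f (Suc j) > 0" using f_pos elim by auto
    have "\<eta> * real j \<ge> \<eta> * (2 / \<eta> + 2 + \<eta>)"
      using elim(3) eta_pos by (intro mult_left_mono) auto
    then have jj: "\<eta> * real j \<ge> 2 + 2 * \<eta> + \<eta> * \<eta>"
      using eta_pos by (simp add: algebra_simps)
    have "real (Suc j) / f (Suc j) \<le> (real j + 1)\<^sup>2 / (f j * (real j + 2 + \<eta>))"
    proof -
      have "real (Suc j) / f (Suc j) = (real j + 1)\<^sup>2 / (f (Suc j) * (real j + 1))"
        by (simp add: power2_eq_square)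
      also have "\<dots> \<le> (real j + 1)\<^sup>2 / (f j * (real j + 2 + \<eta>))"
        using elim(1) fj eta_pos by (intro divide_left_mono) (auto intro!: mult_pos_pos simp: fSj)
      finally show ?thesis .
    qed
    moreover have "real j / f j - (real j + 1)\<^sup>2 / (f j * (real j + 2 + \<eta>))
        = (1 / f j) * ((\<eta> * real j - 1) / (real j + 2 + \<eta>))"
    proof -
      define z where "z = real j + 2 + \<eta>"
      have z: "z > 0" "\<eta> = z - real j - 2" using eta_pos by (simp_all add: z_def)
      show ?thesis
        unfolding z_def[symmetric] unfolding z(2) using fj z(1)
        by (simp add: divide_simps) (simp add: algebra_simps power2_eq_square)
    qed
    moreover have "(\<eta> * real j - 1) / (real j + 2 + \<eta>) \<ge> \<eta> / 2"
      using jj eta_pos by (simp add: field_simps)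
    ultimately have "real j / f j - real (Suc j) / f (Suc j) \<ge> (1 / f j) * (\<eta> / 2)"
      using fj by (smt (verit) divide_nonneg_pos mult_left_mono)
    then have "2 / \<eta> * (real j / f j - real (Suc j) / f (Suc j)) \<ge> 2 / \<eta> * ((1 / f j) * (\<eta> / 2))"
      using eta_pos by (intro mult_left_mono) auto
    then show ?case
      using eta_pos by simp
  qed
qed (use eta_pos in simp)

section \<open>Tails of the series of 1 / f\<close>

definition tail :: "nat \<Rightarrow> real" where
  "tail n = (\<Sum>j. 1 / f (n + j))"

text \<open>Sum the telescoping bound and drop the nonnegative term at the far end. The bounded
  partial sums give convergence and the size of the tail together.\<close>

lemma tail_bound:
  "\<exists>C>0. \<forall>\<^sub>F n in sequentially. summable (\<lambda>j. 1 / f (n + j)) \<and> tail n \<le> C * (real n / f n)"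
proof -
  obtain C where C: "C > 0"
      "\<forall>\<^sub>F j in sequentially. 1 / f j \<le> C * (real j / f j - real (Suc j) / f (Suc j))"
    using telescoping_bound by blast
  then obtain N where N: "\<And>j. j \<ge> N \<Longrightarrow> 1 / f j \<le> C * (real j / f j - real (Suc j) / f (Suc j))"
    by (auto simp: eventually_at_top_linorder)
  have "summable (\<lambda>j. 1 / f (n + j)) \<and> tail n \<le> C * (real n / f n)" if n: "n \<ge> max 1 N" for n
  proof -
    have tel: "(\<Sum>j<k. 1 / f (n + j)) \<le> C * (real n / f n - real (n + k) / f (n + k))" for k
    proof (induction k)
      case (Suc k)
      show ?case using Suc N[of "n + k"] n by (simp add: algebra_simps)
    qed simp
    have sums: "(\<Sum>j<k. 1 / f (n + j)) \<le> C * (real n / f n)" for k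
      by (rule order_trans[OF tel mult_left_mono])
        (use f_pos[of "n + k"] n C in \<open>auto intro!: divide_nonneg_pos\<close>)
    have nn: "0 \<le> 1 / f (n + j)" for j
      using f_pos[of "n + j"] n by simp
    have "summable (\<lambda>j. 1 / f (n + j))"
      by (rule bounded_imp_summable[OF nn, of _ "C * (real n / f n)"])
        (use sums[of "Suc _"] in \<open>simp only: lessThan_Suc_atMost\<close>)
    then show ?thesis
      using suminf_le_const[OF _ sums] by (simp add: tail_def)
  qed
  then show ?thesis
    using C(1) unfolding eventually_at_top_linorder by blast
qed

text \<open>Convergence is insensitive to finitely many terms, so it also holds from n = 0, whatever
  the value \<open>f 0\<close>.\<close>

lemma summable_inverse: "summable (\<lambda>j. 1 / f (n + j))"
proof -
  obtain N where "summable (\<lambda>j. 1 / f (N + j))"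
    using tail_bound by (auto simp: eventually_at_top_linorder)
  then have "summable (\<lambda>j. 1 / f j)"
    using summable_iff_shift[of "\<lambda>j. 1 / f j" N] by (simp add: add.commute)
  then show ?thesis
    using summable_iff_shift[of "\<lambda>j. 1 / f j" n] by (simp add: add.commute)
qed

lemma tail_rec: "tail n = 1 / f n + tail (Suc n)"
  unfolding tail_def using suminf_split_head[OF summable_inverse[of n]] by simp

lemma tail_split: "a \<le> b \<Longrightarrow> tail a = S1 f a b + tail b"
proof (induction b rule: dec_induct)
  case base
  then show ?case by (simp add: S1_def)
next
  case (step b)
  then show ?case using tail_rec[of b] by (simp add: S1_def)
qed

lemma S1_nonneg: "a \<ge> 1 \<Longrightarrow> S1 f a b \<ge> 0"
  unfolding S1_def by (intro sum_nonneg) (auto intro!: f_pos[THEN less_imp_le])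

lemma tail_pos: "n \<ge> 1 \<Longrightarrow> tail n > 0"
  unfolding tail_def using f_pos by (intro suminf_pos summable_inverse) auto

lemma tail_antimono: "1 \<le> a \<Longrightarrow> a \<le> b \<Longrightarrow> tail b \<le> tail a"
  using tail_split[of a b] S1_nonneg[of a b] by simp

lemma tail_tendsto_0: "tail \<longlonglongrightarrow> 0"
proof -
  have "(\<lambda>n. \<Sum>j. 1 / f (0 + (j + n))) \<longlonglongrightarrow> 0"
    using summable_inverse[of 0] by (intro suminf_exist_split2) simp
  then show ?thesis by (simp add: tail_def[abs_def] add.commute)
qed

section \<open>Single terms and tails compared with finite sums\<close>

lemma ratio_shift: "(\<lambda>a. f (a + d) / f a) \<longlonglongrightarrow> 1"
proof (induction d)
  case 0
  have "\<forall>\<^sub>F a in sequentially. f (a + 0) / f a = 1"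
    using eventually_ge_at_top[of 1] by eventually_elim (use f_pos in force)
  then show ?case by (rule tendsto_eventually)
next
  case (Suc d)
  have "(\<lambda>a. f (Suc (a + d)) / f (a + d)) \<longlonglongrightarrow> 1"
    using LIMSEQ_ignore_initial_segment[OF ratio, of d] .
  from tendsto_mult[OF this Suc]
  have "(\<lambda>a. f (Suc (a + d)) / f (a + d) * (f (a + d) / f a)) \<longlonglongrightarrow> 1" by simp
  moreover have "\<forall>\<^sub>F a in sequentially. f (Suc (a + d)) / f (a + d) * (f (a + d) / f a) = f (a + Suc d) / f a"
    using eventually_ge_at_top[of 1]
  proof eventually_elim
    case (elim a)
    then show ?case using f_pos[of "a + d"] by simp
  qed
  ultimately show ?case by (rule Lim_transform_eventually)
qed

text \<open>For fixed D the ratios f (a + d) / f a with d < D are all below 2 eventually, so each of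
  the first D terms of the sum is at least half of 1 / f a. Hence a single term is negligible
  against a long sum.\<close>

lemma weight_times_S1:
  "\<forall>\<^sub>F a in sequentially. \<forall>b\<ge>a + D. real D \<le> 2 * (f a * S1 f a b)"
proof -
  have "\<forall>\<^sub>F a in sequentially. f (a + d) / f a < 2" for d
    using order_tendstoD(2)[OF ratio_shift[of d], of 2] by simp
  then have "\<forall>\<^sub>F a in sequentially. \<forall>d\<in>{..<D}. f (a + d) / f a < 2"
    by (intro eventually_ball_finite) auto
  with eventually_ge_at_top[of 1] show ?thesis
  proof eventually_elim
    case (elim a)
    have fa: "f a > 0" using f_pos elim by simp
    show ?case
    proof (intro allI impI)
      fix b assume b: "b \<ge> a + D"
      have "real D = (\<Sum>j\<in>{a..<a + D}. 1)" by simp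
      also have "\<dots> \<le> (\<Sum>j\<in>{a..<a + D}. 2 * (f a * (1 / f j)))"
      proof (rule sum_mono)
        fix j assume j: "j \<in> {a..<a + D}"
        then have "f (a + (j - a)) / f a < 2" using elim(2) by (intro bspec[OF elim(2)]) auto
        then show "1 \<le> 2 * (f a * (1 / f j))"
          using j fa f_pos[of j] elim(1) by (simp add: field_simps)
      qed
      also have "\<dots> = 2 * (f a * (\<Sum>j\<in>{a..<a + D}. 1 / f j))"
        by (simp add: sum_distrib_left)
      also have "\<dots> \<le> 2 * (f a * S1 f a b)"
        unfolding S1_def using fa b elim(1) f_pos
        by (intro mult_left_mono sum_mono2) (auto intro!: f_pos[THEN less_imp_le])
      finally show "real D \<le> 2 * (f a * S1 f a b)" .
    qed
  qed
qed

text \<open>By monotonicity the sum is at least (b - a) / f b, which is at least \<kappa> / (1 +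
  \<kappa>) times b / f b. The part of the tail beyond b is at most a multiple of the same
  quantity.\<close>

lemma tail_le_S1:
  assumes "\<kappa> > 0"
  shows "\<exists>C>0. \<forall>\<^sub>F a in sequentially. \<forall>b. real b \<ge> (1 + \<kappa>) * real a \<longrightarrow> tail a \<le> C * S1 f a b"
proof -
  obtain C N where C: "C > 0" "\<And>n. n \<ge> N \<Longrightarrow> tail n \<le> C * (real n / f n)"
    using tail_bound by (auto simp: eventually_at_top_linorder)
  have "tail a \<le> (1 + C * ((1 + \<kappa>) / \<kappa>)) * S1 f a b"
    if a: "a \<ge> max 1 N" and b: "real b \<ge> (1 + \<kappa>) * real a" for a b
  proof -
    have "real a \<le> (1 + \<kappa>) * real a" using assms by (simp add: algebra_simps)
    then have ab: "a \<le> b" using b by linarith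
    have fb: "f b > 0" using f_pos[of b] a ab by simp
    have "(\<Sum>j\<in>{a..<b}. 1 / f b) \<le> S1 f a b"
      unfolding S1_def
      by (intro sum_mono divide_left_mono) (use a fb f_pos f_mono in auto)
    then have "(real b - real a) / f b \<le> S1 f a b"
      using ab by (simp add: of_nat_diff)
    moreover have "\<kappa> / (1 + \<kappa>) * real b \<le> real b - real a"
      using b assms by (simp add: field_simps)
    ultimately have "\<kappa> / (1 + \<kappa>) * real b / f b \<le> S1 f a b"
      using fb by (meson divide_right_mono less_imp_le order_trans)
    then have "(1 + \<kappa>) / \<kappa> * (\<kappa> / (1 + \<kappa>) * real b / f b) \<le> (1 + \<kappa>) / \<kappa> * S1 f a b"
      using assms by (intro mult_left_mono) auto
    then have "real b / f b \<le> (1 + \<kappa>) / \<kappa> * S1 f a b"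
      using assms by simp
    then have "C * (real b / f b) \<le> C * ((1 + \<kappa>) / \<kappa> * S1 f a b)"
      using C(1) by (intro mult_left_mono) auto
    then have "tail b \<le> C * ((1 + \<kappa>) / \<kappa> * S1 f a b)"
      using C(2)[of b] a ab by linarith
    then show ?thesis
      using tail_split[OF ab] by (simp add: algebra_simps)
  qed
  then show ?thesis
    using C(1) assms unfolding eventually_at_top_linorder
    by (intro exI[of _ "1 + C * ((1 + \<kappa>) / \<kappa>)"]) (auto intro!: add_pos_pos exI[of _ "max 1 N"])
qed

end

lemma valid_feedback_tame:
  assumes "valid_feedback f"
  obtains \<eta> where "tame_feedback f \<eta>"
proof -
  obtain \<eta> where eta: "\<eta> > 0"
    "\<forall>\<^sub>F j in sequentially. f (Suc j) * (real j + 1) \<ge> f j * (real j + 2 + \<eta>)"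
    using valid_feedback_growth[OF assms] by blast
  have "tame_feedback f \<eta>"
  proof
    show "f m \<le> f n" if "1 \<le> m" "m \<le> n" for m n
      using assms that unfolding valid_feedback_def by (auto simp: mono_on_def)
    show "f n > 0" if "1 \<le> n" for n
      using assms that unfolding valid_feedback_def by auto
  qed (use eta valid_feedback_ratio[OF assms] in auto)
  then show thesis by (rule that)
qed

section \<open>The Markov property of the path measure\<close>

lemma other_other [simp]: "other_bin (other_bin i) = i"
  by (cases i) auto

lemma load_add_ball [simp]:
  "load i (add_ball i s) = Suc (load i s)"
  "load (other_bin i) (add_ball i s) = load (other_bin i) s"
  "load i (add_ball (other_bin i) s) = load i s"
  by (cases i; cases s; simp)+

lemma add_ball_inject [simp]: "add_ball i s = add_ball j s \<longleftrightarrow> i = j"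
  by (cases i; cases j; cases s; simp)

lemma bin_exhaust2: "j = i \<or> j = other_bin i"
  by (cases i; cases j) auto

lemma state_eq_iff: "s = s' \<longleftrightarrow> load i s = load i s' \<and> load (other_bin i) s = load (other_bin i) s'"
  by (cases i; cases s; cases s') auto

lemma load_sum: "load i s + load (other_bin i) s = fst s + snd s"
  by (cases i) auto

definition step_pmf :: "(nat \<Rightarrow> real) \<Rightarrow> nat \<times> nat \<Rightarrow> (nat \<times> nat) pmf" where
  "step_pmf f s = map_pmf (\<lambda>i. add_ball i s) (next_bin f s)"

lemma pmf_next_bin:
  assumes "f (fst s) > 0" "f (snd s) > 0"
  shows "pmf (next_bin f s) i = f (load i s) / (f (fst s) + f (snd s))"
proof -
  have inj: "inj (\<lambda>b. if b then Bin1 else Bin2)"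
    by (auto simp: inj_def split: if_splits)
  have p: "f (fst s) / (f (fst s) + f (snd s)) \<in> {0..1}"
    using assms by (simp add: divide_simps)
  show ?thesis
  proof (cases i)
    case Bin1
    have "pmf (next_bin f s) ((\<lambda>b. if b then Bin1 else Bin2) True) = f (load i s) / (f (fst s) + f (snd s))"
      unfolding next_bin_def by (subst pmf_map_inj'[OF inj]) (use p Bin1 in simp)
    then show ?thesis using Bin1 by simp
  next
    case Bin2
    have "pmf (next_bin f s) ((\<lambda>b. if b then Bin1 else Bin2) False) = f (load i s) / (f (fst s) + f (snd s))"
      unfolding next_bin_def
      by (subst pmf_map_inj'[OF inj]) (use p Bin2 assms in \<open>simp add: field_simps\<close>)
    then show ?thesis using Bin2 by simp
  qed
qed

lemma pmf_step:
  assumes "f (fst s) > 0" "f (snd s) > 0"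
  shows "pmf (step_pmf f s) (add_ball i s) = f (load i s) / (f (fst s) + f (snd s))"
  unfolding step_pmf_def
  by (subst pmf_map_inj'[where f = "\<lambda>i. add_ball i s"])
    (auto simp: inj_def pmf_next_bin[OF assms])

lemma pmf_step_zero: "(\<And>i. s' \<noteq> add_ball i s) \<Longrightarrow> pmf (step_pmf f s) s' = 0"
  by (auto simp: step_pmf_def pmf_eq_0_set_pmf)

section \<open>Events determined by finitely many steps\<close>

lemma measurable_state [measurable]:
  "(\<lambda>\<omega>. \<omega> i) \<in> measurable (bins_process f u) (count_space UNIV)"
  unfolding measurable_cong_sets[OF sets_bins_process refl]
  by (rule measurable_component_singleton) simp

text \<open>For a countable state space these are exactly the events known at time m. One
  implication suffices, because the two paths may be exchanged.\<close>

definition determined_by_prefix :: "nat \<Rightarrow> ((nat \<Rightarrow> 'a) \<Rightarrow> bool) \<Rightarrow> bool" where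
  "determined_by_prefix m X \<longleftrightarrow> (\<forall>\<omega> \<omega>'. (\<forall>i\<le>m. \<omega> i = \<omega>' i) \<longrightarrow> X \<omega> \<longrightarrow> X \<omega>')"

text \<open>A decomposition into countably many cylinders, indexed by lists of length m + 1. A list
  is read as the path \<open>(!) xs\<close>, and \<open>X\<close> inspects only coordinates inside
  the list.\<close>

lemma determined_by_prefix_UN:
  assumes "determined_by_prefix m X"
  shows "{\<omega>. X \<omega>} = (\<Union>xs\<in>{xs. length xs = Suc m \<and> X ((!) xs)}. {\<omega>. \<forall>i<Suc m. \<omega> i = xs ! i})"
proof (intro equalityI subsetI)
  fix \<omega> assume "\<omega> \<in> {\<omega>. X \<omega>}"
  then have "X ((!) (map \<omega> [0..<Suc m]))"
    using assms unfolding determined_by_prefix_def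
    by (smt (verit) add_0 diff_zero le_imp_less_Suc length_upt mem_Collect_eq nth_map nth_upt)
  then show "\<omega> \<in> (\<Union>xs\<in>{xs. length xs = Suc m \<and> X ((!) xs)}. {\<omega>. \<forall>i<Suc m. \<omega> i = xs ! i})"
    by (intro UN_I[of "map \<omega> [0..<Suc m]"]) (auto simp del: upt_Suc)
next
  fix \<omega> assume "\<omega> \<in> (\<Union>xs\<in>{xs. length xs = Suc m \<and> X ((!) xs)}. {\<omega>. \<forall>i<Suc m. \<omega> i = xs ! i})"
  then obtain xs where "X ((!) xs)" "\<forall>i<Suc m. \<omega> i = xs ! i" by auto
  then show "\<omega> \<in> {\<omega>. X \<omega>}"
    using assms unfolding determined_by_prefix_def less_Suc_eq_le by (metis mem_Collect_eq)
qed

lemma sets_prefix: "{\<omega>. \<forall>i<n. \<omega> i = v i} \<in> sets (bins_process f u)"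
proof -
  have "{\<omega> \<in> space (bins_process f u). \<forall>i<n. \<omega> i = v i} \<in> sets (bins_process f u)"
    by measurable
  then show ?thesis by (simp add: space_bins_process)
qed

lemma sets_determined:
  assumes "determined_by_prefix m X"
  shows "{\<omega>. X \<omega>} \<in> sets (bins_process f u)"
  unfolding determined_by_prefix_UN[OF assms]
proof (rule sets.countable_UN')
  have "{\<omega>. \<forall>i<Suc m. \<omega> i = xs ! i} \<in> sets (bins_process f u)" for xs :: "(nat \<times> nat) list"
    by (rule sets_prefix)
  then show "(\<lambda>xs. {\<omega>. \<forall>i<Suc m. \<omega> i = xs ! i}) ` {xs. length xs = Suc m \<and> X ((!) xs)}
      \<subseteq> sets (bins_process f u)"
    by blast
qed simp

lemma emeasure_determined:
  assumes "determined_by_prefix m X"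
  shows "emeasure (bins_process f u) {\<omega>. X \<omega>} =
    (\<integral>\<^sup>+xs. emeasure (bins_process f u) {\<omega>. \<forall>i<Suc m. \<omega> i = xs ! i}
      \<partial>count_space {xs. length xs = Suc m \<and> X ((!) xs)})"
  unfolding determined_by_prefix_UN[OF assms]
proof (rule emeasure_UN_countable)
  show "disjoint_family_on (\<lambda>xs. {\<omega>. \<forall>i<Suc m. \<omega> i = xs ! i}) {xs. length xs = Suc m \<and> X ((!) xs)}"
    by (auto simp: disjoint_family_on_def list_eq_iff_nth_eq simp del: all_simps)
qed (auto intro: sets_prefix)

text \<open>Split the event into cylinders. Extending a prefix by \<open>s'\<close> multiplies its
  probability by one more kernel factor, and the earlier factors are unchanged because each kernel
  looks only at the preceding state.\<close>

lemma markov_emeasure: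
  assumes "determined_by_prefix m X"
  shows "emeasure (bins_process f u) {\<omega>. X \<omega> \<and> \<omega> m = s \<and> \<omega> (Suc m) = s'}
    = emeasure (bins_process f u) {\<omega>. X \<omega> \<and> \<omega> m = s} * ennreal (pmf (step_pmf f s) s')"
proof -
  let ?J = "{xs. length xs = Suc m \<and> X ((!) xs) \<and> xs ! m = s}"
  let ?A = "\<lambda>xs. {\<omega>. \<forall>i<Suc m. \<omega> i = xs ! i}"
  let ?B = "\<lambda>xs. {\<omega>. \<forall>i<Suc (Suc m). \<omega> i = (xs @ [s']) ! i}"
  have det: "determined_by_prefix m (\<lambda>\<omega>. X \<omega> \<and> \<omega> m = s)"
    using assms unfolding determined_by_prefix_def by auto
  have "{\<omega>. X \<omega> \<and> \<omega> m = s \<and> \<omega> (Suc m) = s'} = {\<omega>. X \<omega> \<and> \<omega> m = s} \<inter> {\<omega>. \<omega> (Suc m) = s'}"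
    by auto
  also have "\<dots> = (\<Union>xs\<in>?J. ?A xs) \<inter> {\<omega>. \<omega> (Suc m) = s'}"
    by (subst determined_by_prefix_UN[OF det]) simp
  also have "\<dots> = (\<Union>xs\<in>?J. ?B xs)"
    by (auto simp: less_Suc_eq nth_append)
  finally have eq: "{\<omega>. X \<omega> \<and> \<omega> m = s \<and> \<omega> (Suc m) = s'} = (\<Union>xs\<in>?J. ?B xs)" .
  have "emeasure (bins_process f u) (\<Union>xs\<in>?J. ?B xs)
      = (\<integral>\<^sup>+xs. emeasure (bins_process f u) (?B xs) \<partial>count_space ?J)"
  proof (rule emeasure_UN_countable)
    show "disjoint_family_on ?B ?J"
      unfolding disjoint_family_on_def
    proof (intro ballI impI)
      fix xs ys assume *: "xs \<in> ?J" "ys \<in> ?J" "xs \<noteq> ys"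
      then obtain i where "i < Suc m" "xs ! i \<noteq> ys ! i"
        by (auto simp: list_eq_iff_nth_eq)
      then show "?B xs \<inter> ?B ys = {}"
        using * by (auto simp: nth_append dest!: spec[of _ i])
    qed
  qed (rule sets_prefix, simp)
  also have "\<dots> = (\<integral>\<^sup>+xs. emeasure (bins_process f u) (?A xs) * ennreal (pmf (step_pmf f s) s') \<partial>count_space ?J)"
  proof (rule nn_integral_cong)
    fix xs assume "xs \<in> space (count_space ?J)"
    then have xs: "length xs = Suc m" "xs ! m = s" by auto
    have "(\<Prod>i<Suc m. emeasure (bins_kernel f u i ((!) (xs @ [s']))) {(xs @ [s']) ! i})
        = (\<Prod>i<Suc m. emeasure (bins_kernel f u i ((!) xs)) {xs ! i})"
      using xs by (intro prod.cong) (auto simp: bins_kernel_def nth_append split: nat.split)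
    moreover have "emeasure (bins_kernel f u (Suc m) ((!) (xs @ [s']))) {(xs @ [s']) ! Suc m}
        = ennreal (pmf (step_pmf f s) s')"
      using xs by (simp add: bins_kernel_def nth_append step_pmf_def emeasure_pmf_single)
    ultimately show "emeasure (bins_process f u) (?B xs)
        = emeasure (bins_process f u) (?A xs) * ennreal (pmf (step_pmf f s) s')"
      unfolding emeasure_bins_process_prefix prod.lessThan_Suc[of _ "Suc m"] by simp
  qed
  also have "\<dots> = emeasure (bins_process f u) {\<omega>. X \<omega> \<and> \<omega> m = s} * ennreal (pmf (step_pmf f s) s')"
    by (simp add: emeasure_determined[OF det] nn_integral_multc)
  finally show ?thesis unfolding eq .
qed

lemma markov:
  assumes "determined_by_prefix m X"
  shows "measure (bins_process f u) {\<omega>. X \<omega> \<and> \<omega> m = s \<and> \<omega> (Suc m) = s'}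
    = measure (bins_process f u) {\<omega>. X \<omega> \<and> \<omega> m = s} * pmf (step_pmf f s) s'"
  unfolding measure_def markov_emeasure[OF assms] by (simp add: enn2real_mult)

section \<open>Almost sure shape of the paths\<close>

definition regular_path :: "nat \<times> nat \<Rightarrow> (nat \<Rightarrow> nat \<times> nat) \<Rightarrow> bool" where
  "regular_path u \<omega> \<longleftrightarrow> \<omega> 0 = u \<and> (\<forall>m. \<exists>i. \<omega> (Suc m) = add_ball i (\<omega> m))"

text \<open>A time and a pair of states can be chosen in countably many ways, and by the Markov
  property each impossible transition is a null event.\<close>

lemma AE_regular_path: "AE \<omega> in bins_process f u. regular_path u \<omega>"
proof -
  interpret prob_space "bins_process f u" by (rule prob_space_bins_process)
  have "emeasure (bins_process f u) {\<omega>. \<forall>i<1. \<omega> i = u} = 1"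
    using emeasure_bins_process_prefix[of f u 1 "\<lambda>_. u"] by (simp add: bins_kernel_def emeasure_pmf_single)
  then have "prob {\<omega>. \<omega> 0 = u} = 1"
    by (simp add: measure_def)
  then have 1: "AE \<omega> in bins_process f u. \<omega> 0 = u"
    using prob_Collect_eq_1[of "\<lambda>\<omega>. \<omega> 0 = u"] sets_prefix[of 1 "\<lambda>_. u"]
    by (simp add: space_bins_process)
  have "AE \<omega> in bins_process f u. \<forall>m. \<forall>s. \<forall>s'. \<omega> m = s \<and> \<omega> (Suc m) = s' \<longrightarrow> (\<exists>i. s' = add_ball i s)"
    unfolding AE_all_countable
  proof (intro allI)
    fix m s s'
    show "AE \<omega> in bins_process f u. \<omega> m = s \<and> \<omega> (Suc m) = s' \<longrightarrow> (\<exists>i. s' = add_ball i s)"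
    proof (cases "\<exists>i. s' = add_ball i s")
      case False
      then have "emeasure (bins_process f u) {\<omega>. True \<and> \<omega> m = s \<and> \<omega> (Suc m) = s'} = 0"
        by (subst markov_emeasure) (auto simp: determined_by_prefix_def pmf_step_zero)
      then show ?thesis
        using False by (intro AE_I[where N = "{\<omega>. \<omega> m = s \<and> \<omega> (Suc m) = s'}"])
          (auto intro!: sets_determined[of "Suc m"] simp: determined_by_prefix_def)
    qed auto
  qed
  with 1 show ?thesis
    unfolding regular_path_def by eventually_elim blast
qed

lemma regular_path_total:
  "regular_path u \<omega> \<Longrightarrow> load i (\<omega> m) + load (other_bin i) (\<omega> m) = fst u + snd u + m"
proof (induction m)
  case (Suc m)
  then obtain j where "\<omega> (Suc m) = add_ball j (\<omega> m)" unfolding regular_path_def by blast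
  with Suc show ?case using bin_exhaust2[of j i] by auto
qed (simp add: regular_path_def load_sum)

lemma regular_path_mono:
  assumes "regular_path u \<omega>" "m \<le> n"
  shows "load i (\<omega> m) \<le> load i (\<omega> n)"
  using assms(2)
proof (induction n rule: dec_induct)
  case (step n)
  obtain j where "\<omega> (Suc n) = add_ball j (\<omega> n)" using assms(1) unfolding regular_path_def by blast
  with step show ?case using bin_exhaust2[of j i] by auto
qed simp

lemma regular_path_ge:
  assumes "regular_path u \<omega>"
  shows "load i u \<le> load i (\<omega> m)"
  using regular_path_mono[OF assms, of 0 m i] assms by (simp add: regular_path_def)

section \<open>Densities of visits\<close>

locale bins_chain = tame_feedback f \<eta> for f :: "nat \<Rightarrow> real" and \<eta> :: real +
  fixes x y :: nat
  assumes x_ge: "x \<ge> 1" and y_ge: "y \<ge> 1"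
begin

abbreviation P :: "(nat \<Rightarrow> nat \<times> nat) measure" where "P \<equiv> bins_process f (x, y)"

sublocale prob_space P
  by (rule prob_space_bins_process)

lemma prob_mono_regular:
  assumes "\<And>\<omega>. regular_path (x, y) \<omega> \<Longrightarrow> A \<omega> \<Longrightarrow> B \<omega>" "{\<omega>. B \<omega>} \<in> events"
  shows "prob {\<omega>. A \<omega>} \<le> prob {\<omega>. B \<omega>}"
  by (rule finite_measure_mono_AE)
    (use assms AE_regular_path[of "(x, y)" f] in \<open>auto elim: eventually_mono\<close>)

lemma prob_cong_regular:
  assumes "\<And>\<omega>. regular_path (x, y) \<omega> \<Longrightarrow> A \<omega> \<longleftrightarrow> B \<omega>" "{\<omega>. A \<omega>} \<in> events" "{\<omega>. B \<omega>} \<in> events"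
  shows "prob {\<omega>. A \<omega>} = prob {\<omega>. B \<omega>}"
  by (intro antisym prob_mono_regular) (use assms in auto)

lemma events_pred: "Measurable.pred P A \<Longrightarrow> {\<omega>. A \<omega>} \<in> events"
  unfolding pred_def by (simp add: space_bins_process)

lemma regular_load_pos:
  assumes "regular_path (x, y) \<omega>"
  shows "fst (\<omega> m) \<ge> x" "snd (\<omega> m) \<ge> y" "load i (\<omega> m) \<ge> 1"
  using regular_path_ge[OF assms, of i m] regular_path_ge[OF assms, of Bin1 m]
    regular_path_ge[OF assms, of Bin2 m] x_ge y_ge by (cases i; simp)+

lemma regular_total:
  "regular_path (x, y) \<omega> \<Longrightarrow> load i (\<omega> m) + load (other_bin i) (\<omega> m) = x + y + m"
  using regular_path_total[of "(x, y)"] by simp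

lemma transition:
  assumes "determined_by_prefix m X"
  shows "prob {\<omega>. X \<omega> \<and> \<omega> m = s \<and> \<omega> (Suc m) = add_ball i s}
    = prob {\<omega>. X \<omega> \<and> \<omega> m = s} * (f (load i s) / (f (fst s) + f (snd s)))"
proof (cases "fst s \<ge> 1 \<and> snd s \<ge> 1")
  case True
  then show ?thesis
    using f_pos by (subst markov[OF assms]) (simp add: pmf_step)
next
  case False
  \<comment> \<open>With an empty bin the arbitrary value \<open>f 0\<close> enters the transition
    probabilities. Such a state has probability 0, so both sides vanish.\<close>
  have "prob {\<omega>. X \<omega> \<and> \<omega> m = s} \<le> prob {\<omega>. False}"
    using False regular_load_pos(3)[of _ Bin1 m] regular_load_pos(3)[of _ Bin2 m]
    by (intro prob_mono_regular) auto
  then have "prob {\<omega>. X \<omega> \<and> \<omega> m = s} = 0"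
    by (simp add: measure_le_0_iff)
  then show ?thesis
    by (subst markov[OF assms]) simp
qed

lemma prob_state_Suc:
  "prob {\<omega>. \<omega> (Suc m) = (Suc a, Suc b)} =
     prob {\<omega>. \<omega> m = (a, Suc b)} * (f a / (f a + f (Suc b))) +
     prob {\<omega>. \<omega> m = (Suc a, b)} * (f b / (f (Suc a) + f b))"
proof -
  let ?A = "{\<omega>. \<omega> m = (a, Suc b) \<and> \<omega> (Suc m) = (Suc a, Suc b)}"
  let ?B = "{\<omega>. \<omega> m = (Suc a, b) \<and> \<omega> (Suc m) = (Suc a, Suc b)}"
  have det: "determined_by_prefix m (\<lambda>_. True)"
    by (simp add: determined_by_prefix_def)
  have ev: "?A \<in> events" "?B \<in> events"
    by (rule events_pred, measurable)+
  have "prob {\<omega>. \<omega> (Suc m) = (Suc a, Suc b)} =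
      prob {\<omega>. \<omega> m = (a, Suc b) \<and> \<omega> (Suc m) = (Suc a, Suc b) \<or>
        \<omega> m = (Suc a, b) \<and> \<omega> (Suc m) = (Suc a, Suc b)}"
  proof (rule prob_cong_regular)
    fix \<omega> assume "regular_path (x, y) \<omega>"
    then obtain i where "\<omega> (Suc m) = add_ball i (\<omega> m)"
      unfolding regular_path_def by blast
    then show "\<omega> (Suc m) = (Suc a, Suc b) \<longleftrightarrow>
        \<omega> m = (a, Suc b) \<and> \<omega> (Suc m) = (Suc a, Suc b) \<or> \<omega> m = (Suc a, b) \<and> \<omega> (Suc m) = (Suc a, Suc b)"
      by (cases i; cases "\<omega> m") auto
  qed (rule events_pred, measurable)+
  also have "\<dots> = prob (?A \<union> ?B)"
    by (rule arg_cong[where f = prob]) auto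
  also have "\<dots> = prob ?A + prob ?B"
    by (rule finite_measure_Union) (use ev in auto)
  finally show ?thesis
    using transition[OF det, of "(a, Suc b)" Bin1] transition[OF det, of "(Suc a, b)" Bin2]
    by (simp add: add.commute)
qed

lemma prob_state_zero:
  assumes "fst s < x \<or> snd s < y"
  shows "prob {\<omega>. \<omega> m = s} = 0"
proof -
  have "prob {\<omega>. \<omega> m = s} \<le> prob {\<omega>. False}"
    using assms regular_load_pos(1,2)[of _ m]
    by (intro prob_mono_regular) (auto simp: not_less[symmetric])
  then show ?thesis by (simp add: measure_le_0_iff)
qed

text \<open>Up to a shift of indices, \<open>dens (a, b)\<close> is the density at \<open>0\<close> of the difference of the times
  at which the bins reach the loads \<open>a\<close> and \<open>b\<close> when balls arrive in continuous time after independent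
  exponential waiting times with rates \<open>f\<close>.\<close>

definition dens :: "nat \<times> nat \<Rightarrow> real" where
  "dens s = prob {\<omega>. \<omega> (fst s + snd s - (x + y)) = s} *
     (f (fst s) * f (snd s) / (f (fst s) + f (snd s)))"

lemma prob_state:
  assumes "a \<ge> 1" "b \<ge> 1" "a + b = x + y + m"
  shows "prob {\<omega>. \<omega> m = (a, b)} = dens (a, b) * (1 / f a + 1 / f b)"
proof -
  have "f a > 0" "f b > 0" using f_pos assms by auto
  then have "f a * f b / (f a + f b) * (1 / f a + 1 / f b) = 1"
    by (simp add: divide_simps)
  moreover have "a + b - (x + y) = m" using assms(3) by simp
  ultimately show ?thesis
    unfolding dens_def fst_conv snd_conv by (simp only: mult.assoc mult_1_right)
qed

lemma averaged_dens: "averaged (\<lambda>i. f (x + i)) (\<lambda>j. f (y + j)) (\<lambda>i j. dens (x + i, y + j))"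
proof -
  have fx: "f (x + i) > 0" and fy: "f (y + i) > 0" for i
    using f_pos x_ge y_ge by auto
  have fx': "f (Suc (x + i)) > 0" and fy': "f (Suc (y + i)) > 0" for i
    using f_pos by auto
  obtain x' y' where x': "x = Suc x'" and y': "y = Suc y'"
    using x_ge y_ge by (cases x; cases y) auto
  then have lt: "x' < x" "y' < y" by auto
  \<comment> \<open>Primes mark the weights after the last ball. Multiplying the last-ball
    decomposition by A' B' turns each predecessor term into its own density times the weight of the
    new load. Only A' and B' are taken positive, since A or B may be \<open>f 0\<close>.\<close>
  have alg: "(A' + B') * (G * (A' * B' / (A' + B'))) =
      A' * (G1 * (A * B' / (A + B'))) + B' * (G2 * (A' * B / (A' + B)))"
    if "G = G1 * (A / (A + B')) + G2 * (B / (A' + B))" "A' > 0" "B' > 0"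
    for A A' B B' G G1 G2 :: real
  proof -
    have "(A' + B') * (G * (A' * B' / (A' + B'))) = G * (A' * B')"
      using that(2,3) by simp
    then show ?thesis by (simp add: that(1) algebra_simps)
  qed
  show ?thesis
  proof
    show "summable (\<lambda>i. 1 / f (x + i))" "summable (\<lambda>j. 1 / f (y + j))"
      by (rule summable_inverse)+
    have "prob {\<omega>. \<omega> 0 = (x, y)} = prob {\<omega>. True}"
      by (rule prob_cong_regular) (auto simp: regular_path_def intro!: events_pred sets.top[of P, unfolded space_bins_process])
    then show "dens (x + 0, y + 0) > 0"
      using fx[of 0] fy[of 0] prob_space by (simp add: dens_def space_bins_process)
    fix i j
    show "f (x + i) > 0" "f (y + j) > 0" by (rule fx fy)+
    \<comment> \<open>On an axis one of the two predecessors lies below the initial load and has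
      probability 0, which leaves the one-term equation.\<close>
    show "(f (x + Suc i) + f (y + 0)) * dens (x + Suc i, y + 0) = f (x + Suc i) * dens (x + i, y + 0)"
      using alg[OF prob_state_Suc[of i "x + i" y', folded y'] fx' fy[of 0, simplified]]
        prob_state_zero[of "(Suc (x + i), y')" i] lt
      by (simp add: dens_def)
    show "(f (x + 0) + f (y + Suc j)) * dens (x + 0, y + Suc j) = f (y + Suc j) * dens (x + 0, y + j)"
      using alg[OF prob_state_Suc[of j x' "y + j", folded x'] fx[of 0, simplified] fy']
        prob_state_zero[of "(x', Suc (y + j))" j] lt
      by (simp add: dens_def)
    show "(f (x + Suc i) + f (y + Suc j)) * dens (x + Suc i, y + Suc j) =
        f (x + Suc i) * dens (x + i, y + Suc j) + f (y + Suc j) * dens (x + Suc i, y + j)"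
      using alg[OF prob_state_Suc[of "Suc (i + j)" "x + i" "y + j"] fx' fy']
      by (simp add: dens_def)
  qed
qed

lemma dens_limit: "\<exists>l>0. \<forall>e>0. \<exists>n. \<forall>a\<ge>n. \<forall>b\<ge>n. \<bar>dens (a, b) - l\<bar> < e"
proof -
  obtain l where l: "l > 0" "\<And>e. e > 0 \<Longrightarrow> \<exists>n. \<forall>i\<ge>n. \<forall>j\<ge>n. \<bar>dens (x + i, y + j) - l\<bar> < e"
    using averaged.limit[OF averaged_dens] by blast
  have "\<exists>n. \<forall>a\<ge>n. \<forall>b\<ge>n. \<bar>dens (a, b) - l\<bar> < e" if e: "e > 0" for e
  proof -
    obtain n where n: "\<And>i j. i \<ge> n \<Longrightarrow> j \<ge> n \<Longrightarrow> \<bar>dens (x + i, y + j) - l\<bar> < e"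
      using l(2)[OF e] by blast
    have "\<bar>dens (a, b) - l\<bar> < e" if "a \<ge> n + x + y" "b \<ge> n + x + y" for a b
      using n[of "a - x" "b - y"] that by simp
    then show ?thesis by blast
  qed
  then show ?thesis using l(1) by blast
qed

lemma dens_nonneg: "a \<ge> 1 \<Longrightarrow> b \<ge> 1 \<Longrightarrow> dens (a, b) \<ge> 0"
  unfolding dens_def using f_pos[of a] f_pos[of b] by simp

lemma dens_le: "dens (a, b) \<le> dens (x, y)"
proof (cases "a < x \<or> b < y")
  case True
  then have "dens (a, b) = 0" by (simp add: dens_def prob_state_zero)
  then show ?thesis using dens_nonneg[OF x_ge y_ge] by simp
next
  case False
  then show ?thesis
    using averaged.upper[OF averaged_dens, of "a - x" "b - y"] by simp
qed

lemma prob_both_ge: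
  assumes "a \<ge> 1"
  shows "prob {\<omega>. \<forall>i. a \<le> load i (\<omega> m)} =
    (\<Sum>k\<in>{a..<Suc (x + y + m) - a}. dens (k, x + y + m - k) * (1 / f k + 1 / f (x + y + m - k)))"
proof -
  let ?n = "x + y + m"
  let ?K = "{a..<Suc ?n - a}"
  have "prob {\<omega>. \<forall>i. a \<le> load i (\<omega> m)} = prob {\<omega>. \<exists>k\<in>?K. \<omega> m = (k, ?n - k)}"
  proof (rule prob_cong_regular)
    fix \<omega> assume "regular_path (x, y) \<omega>"
    from regular_total[OF this, of Bin1 m]
    have "fst (\<omega> m) + snd (\<omega> m) = ?n" by simp
    moreover have "(\<forall>i. a \<le> load i (\<omega> m)) \<longleftrightarrow> a \<le> fst (\<omega> m) \<and> a \<le> snd (\<omega> m)"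
      by (metis bin.exhaust load.simps)
    ultimately show "(\<forall>i. a \<le> load i (\<omega> m)) \<longleftrightarrow> (\<exists>k\<in>?K. \<omega> m = (k, ?n - k))"
      by (cases "\<omega> m") auto
  next
    have "(\<forall>i. a \<le> load i s) \<longleftrightarrow> a \<le> fst s \<and> a \<le> snd s" for s
      by (metis bin.exhaust load.simps)
    then show "{\<omega>. \<forall>i. a \<le> load i (\<omega> m)} \<in> events"
      by (simp only:) (rule events_pred, measurable)
  qed (rule events_pred, measurable)
  also have "{\<omega>. \<exists>k\<in>?K. \<omega> m = (k, ?n - k)} = (\<Union>k\<in>?K. {\<omega>. \<omega> m = (k, ?n - k)})"
    by auto
  also have "prob \<dots> = (\<Sum>k\<in>?K. prob {\<omega>. \<omega> m = (k, ?n - k)})"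
    by (rule finite_measure_finite_Union)
      (auto simp: disjoint_family_on_def intro!: events_pred)
  also have "\<dots> = (\<Sum>k\<in>?K. dens (k, ?n - k) * (1 / f k + 1 / f (?n - k)))"
    using assms by (intro sum.cong refl prob_state) auto
  finally show ?thesis .
qed

text \<open>The reflection of k to n - k identifies the two halves; this is the origin of the factor
  2 in c = 2 l. The closed range a \<le> k \<le> n - a makes the excluded upper end
  \<open>Suc n - a\<close>.\<close>

lemma sum_inverse_eq_S1:
  "(\<Sum>k\<in>{a..<Suc n - a}. 1 / f k + 1 / f (n - k)) = 2 * S1 f a (Suc n - a)"
proof -
  have "(\<Sum>k\<in>{a..<Suc n - a}. 1 / f (n - k)) = S1 f a (Suc n - a)"
    unfolding S1_def
    by (rule sum.reindex_bij_witness[of _ "\<lambda>k. n - k" "\<lambda>k. n - k"]) auto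
  then show ?thesis
    by (simp add: sum.distrib S1_def)
qed

lemma prob_both_ge_approx:
  assumes "a \<ge> 1" "\<And>k k'. k \<ge> a \<Longrightarrow> k' \<ge> a \<Longrightarrow> \<bar>dens (k, k') - l\<bar> \<le> e"
  shows "\<bar>prob {\<omega>. \<forall>i. a \<le> load i (\<omega> m)} - 2 * l * S1 f a (Suc (x + y + m) - a)\<bar>
    \<le> 2 * e * S1 f a (Suc (x + y + m) - a)"
proof -
  let ?n = "x + y + m"
  let ?K = "{a..<Suc ?n - a}"
  let ?w = "\<lambda>k. 1 / f k + 1 / f (?n - k)"
  have "prob {\<omega>. \<forall>i. a \<le> load i (\<omega> m)} - 2 * l * S1 f a (Suc ?n - a)
      = (\<Sum>k\<in>?K. (dens (k, ?n - k) - l) * ?w k)"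
    unfolding prob_both_ge[OF assms(1)] left_diff_distrib sum_subtractf
    by (simp add: sum_inverse_eq_S1 flip: sum_distrib_left)
  also have "\<bar>\<dots>\<bar> \<le> (\<Sum>k\<in>?K. e * ?w k)"
  proof (rule order_trans[OF sum_abs sum_mono])
    fix k assume k: "k \<in> ?K"
    then have "f k > 0" "f (?n - k) > 0"
      using f_pos assms(1) by auto
    then have "?w k \<ge> 0" by simp
    moreover have "\<bar>dens (k, ?n - k) - l\<bar> \<le> e"
      using k by (intro assms(2)) auto
    ultimately show "\<bar>(dens (k, ?n - k) - l) * ?w k\<bar> \<le> e * ?w k"
      by (simp add: abs_mult mult_right_mono)
  qed
  also have "\<dots> = 2 * e * S1 f a (Suc ?n - a)"
    by (simp add: sum_inverse_eq_S1 flip: sum_distrib_left)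
  finally show ?thesis .
qed

end

section \<open>Overtaking by the trailing bin\<close>

context tame_feedback
begin

text \<open>In the continuous-time picture with exponential waiting times, the time for a bin at
  load n to receive infinitely many balls has mean \<open>tail n\<close> and variance
  \<open>tail2 n\<close>.\<close>

definition tail2 :: "nat \<Rightarrow> real" where
  "tail2 n = (\<Sum>j. (1 / f (n + j))\<^sup>2)"

lemma square_inverse_le: "n \<ge> 1 \<Longrightarrow> (1 / f (n + j))\<^sup>2 \<le> 1 / f n * (1 / f (n + j))"
  using f_pos[of n] f_pos[of "n + j"] f_mono[of n "n + j"]
  unfolding power2_eq_square by (intro mult_right_mono) (auto intro: divide_left_mono)

lemma summable_square: "n \<ge> 1 \<Longrightarrow> summable (\<lambda>j. (1 / f (n + j))\<^sup>2)"
  by (rule summable_comparison_test'[OF summable_mult[OF summable_inverse[of n], of "1 / f n"], of 0])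
    (use square_inverse_le in auto)

lemma tail2_rec: "n \<ge> 1 \<Longrightarrow> tail2 n = (1 / f n)\<^sup>2 + tail2 (Suc n)"
  unfolding tail2_def using suminf_split_head[OF summable_square[of n]] by simp

lemma tail2_nonneg: "n \<ge> 1 \<Longrightarrow> tail2 n \<ge> 0"
  unfolding tail2_def by (intro suminf_nonneg summable_square) auto

lemma tail2_antimono:
  assumes "1 \<le> a" "a \<le> b"
  shows "tail2 b \<le> tail2 a"
  using assms(2)
proof (induction b rule: dec_induct)
  case (step b)
  have "tail2 (Suc b) \<le> tail2 b"
    using tail2_rec[of b] zero_le_power2[of "1 / f b"] step assms(1) by linarith
  then show ?case using step by simp
qed simp

lemma tail2_le: "n \<ge> 1 \<Longrightarrow> tail2 n \<le> tail n / f n"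
proof -
  assume n: "n \<ge> 1"
  have "tail2 n \<le> (\<Sum>j. 1 / f n * (1 / f (n + j)))"
    unfolding tail2_def
    by (intro suminf_le summable_square summable_mult summable_inverse square_inverse_le n)
  also have "\<dots> = tail n / f n"
    using suminf_mult[OF summable_inverse[of n], of "1 / f n"] by (simp add: tail_def)
  finally show ?thesis .
qed

text \<open>Harmonicity for the transition kernel, so that g is a martingale along the chain. It is
  required at states with two nonempty bins, since \<open>f 0\<close> is arbitrary.\<close>

definition harmonic :: "(nat \<times> nat \<Rightarrow> real) \<Rightarrow> bool" where
  "harmonic g \<longleftrightarrow> (\<forall>a\<ge>1. \<forall>b\<ge>1. g (a, b) =
     f a / (f a + f b) * g (Suc a, b) + f b / (f a + f b) * g (a, Suc b))"

text \<open>A ball lowers the tail difference by a = 1 / A or raises it by b = 1 / B, with odds A :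
  B. The cross terms cancel because A a = B b, and the squares a^2 and b^2 are exactly what the
  \<open>tail2\<close> terms lose.\<close>

lemma harmonic_square1:
  "harmonic (\<lambda>s. (tail (fst s) - tail (snd s) - c)\<^sup>2 + (tail2 (fst s) + tail2 (snd s)))"
  unfolding harmonic_def
proof (intro allI impI)
  fix p q :: nat assume pq: "p \<ge> 1" "q \<ge> 1"
  define A B where "A = f p" and "B = f q"
  have AB: "A > 0" "B > 0" using f_pos pq by (simp_all add: A_def B_def)
  define a b where "a = 1 / A" and "b = 1 / B"
  have ab: "A * a = 1" "B * b = 1" using AB by (simp_all add: a_def b_def)
  define z where "z = tail p - tail q - c"
  have r: "tail p = a + tail (Suc p)" "tail q = b + tail (Suc q)"
    using tail_rec[of p] tail_rec[of q] by (simp_all add: a_def b_def A_def B_def)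
  have r2: "tail2 p = a\<^sup>2 + tail2 (Suc p)" "tail2 q = b\<^sup>2 + tail2 (Suc q)"
    using tail2_rec[of p] tail2_rec[of q] pq by (simp_all add: a_def b_def A_def B_def)
  have z1: "tail (Suc p) - tail q - c = z - a" and z2: "tail p - tail (Suc q) - c = z + b"
    using r by (simp_all add: z_def)
  have "(A + B) * (z\<^sup>2 + (tail2 p + tail2 q)) =
      A * ((z - a)\<^sup>2 + (tail2 (Suc p) + tail2 q)) + B * ((z + b)\<^sup>2 + (tail2 p + tail2 (Suc q)))"
  proof -
    have "(A + B) * (z\<^sup>2 + ((a\<^sup>2 + t) + (b\<^sup>2 + r))) -
        (A * ((z - a)\<^sup>2 + (t + (b\<^sup>2 + r))) + B * ((z + b)\<^sup>2 + ((a\<^sup>2 + t) + r)))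
        = 2 * z * (A * a - B * b)" for t r
      by (simp add: power2_eq_square algebra_simps)
    then show ?thesis unfolding r2 ab by simp
  qed
  then have "z\<^sup>2 + (tail2 p + tail2 q) =
      (A * ((z - a)\<^sup>2 + (tail2 (Suc p) + tail2 q)) + B * ((z + b)\<^sup>2 + (tail2 p + tail2 (Suc q)))) / (A + B)"
    using AB by (simp add: nonzero_eq_divide_eq mult.commute)
  then show "(tail (fst (p, q)) - tail (snd (p, q)) - c)\<^sup>2 + (tail2 (fst (p, q)) + tail2 (snd (p, q))) =
    f p / (f p + f q) * ((tail (fst (Suc p, q)) - tail (snd (Suc p, q)) - c)\<^sup>2 + (tail2 (fst (Suc p, q)) + tail2 (snd (Suc p, q)))) +
    f q / (f p + f q) * ((tail (fst (p, Suc q)) - tail (snd (p, Suc q)) - c)\<^sup>2 + (tail2 (fst (p, Suc q)) + tail2 (snd (p, Suc q))))"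
    unfolding fst_conv snd_conv z1 z2 z_def[symmetric] A_def[symmetric] B_def[symmetric]
    by (simp add: add_divide_distrib)
qed

text \<open>The difference of the tails is a martingale along the chain, and the square sums of the
  remaining increments compensate its square.\<close>

lemma harmonic_square:
  "harmonic (\<lambda>s. (tail (load i s) - tail (load (other_bin i) s) - c)\<^sup>2 + (tail2 (fst s) + tail2 (snd s)))"
proof (cases i)
  case Bin1
  then show ?thesis using harmonic_square1[of c] by simp
next
  case Bin2
  have "(tail q - tail p - c)\<^sup>2 = (tail p - tail q - (- c))\<^sup>2" for p q
    by (simp add: power2_eq_square algebra_simps)
  then show ?thesis using harmonic_square1[of "- c"] Bin2 by simp
qed

end

lemma determined_by_prefix_mono:
  "determined_by_prefix m X \<Longrightarrow> m \<le> n \<Longrightarrow> determined_by_prefix n X"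
  unfolding determined_by_prefix_def using order_trans by blast

section \<open>Martingale inequalities along the chain\<close>

context bins_chain
begin

text \<open>A finite set that almost surely contains the state at time m, so that expectations
  become finite sums.\<close>

definition states :: "nat \<Rightarrow> (nat \<times> nat) set" where
  "states m = {s. fst s \<ge> 1 \<and> snd s \<ge> 1 \<and> fst s + snd s = x + y + m}"

lemma finite_states: "finite (states m)"
  by (rule finite_subset[of _ "{..x + y + m} \<times> {..x + y + m}"]) (auto simp: states_def)

lemma regular_states: "regular_path (x, y) \<omega> \<Longrightarrow> \<omega> m \<in> states m"
  using regular_load_pos(3)[of \<omega> Bin1 m] regular_load_pos(3)[of \<omega> Bin2 m] regular_total[of \<omega> Bin1 m]
  by (simp add: states_def)

lemma total_prob:
  assumes "{\<omega>. A \<omega>} \<in> events"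
  shows "prob {\<omega>. A \<omega>} = (\<Sum>s\<in>states m. prob {\<omega>. A \<omega> \<and> \<omega> m = s})"
proof -
  have ev: "{\<omega>. A \<omega> \<and> \<omega> m = s} \<in> events" for s
  proof -
    have "{\<omega>. A \<omega>} \<inter> {\<omega>. \<omega> m = s} \<in> events"
      by (intro sets.Int assms events_pred) measurable
    then show ?thesis by (simp add: Int_def)
  qed
  have UN: "(\<Union>s\<in>states m. {\<omega>. A \<omega> \<and> \<omega> m = s}) \<in> events"
    using ev by (intro sets.finite_UN finite_states) auto
  have "prob {\<omega>. A \<omega>} = prob {\<omega>. \<exists>s\<in>states m. A \<omega> \<and> \<omega> m = s}"
  proof (rule prob_cong_regular)
    have "{\<omega>. \<exists>s\<in>states m. A \<omega> \<and> \<omega> m = s} = (\<Union>s\<in>states m. {\<omega>. A \<omega> \<and> \<omega> m = s})"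
      by auto
    then show "{\<omega>. \<exists>s\<in>states m. A \<omega> \<and> \<omega> m = s} \<in> events"
      using UN by (simp only:)
  qed (use regular_states assms in auto)
  also have "{\<omega>. \<exists>s\<in>states m. A \<omega> \<and> \<omega> m = s} = (\<Union>s\<in>states m. {\<omega>. A \<omega> \<and> \<omega> m = s})"
    by auto
  also have "prob \<dots> = (\<Sum>s\<in>states m. prob {\<omega>. A \<omega> \<and> \<omega> m = s})"
    by (rule finite_measure_finite_Union)
      (use ev finite_states in \<open>auto simp: disjoint_family_on_def\<close>)
  finally show ?thesis .
qed

text \<open>The martingale property tested on an event of the first m steps: the two sums are the
  expectations of g over \<open>X\<close> at consecutive times.\<close>

lemma harmonic_step:
  assumes X: "determined_by_prefix m X" and g: "harmonic g"
  shows "(\<Sum>s\<in>states (Suc m). prob {\<omega>. X \<omega> \<and> \<omega> (Suc m) = s} * g s)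
    = (\<Sum>s\<in>states m. prob {\<omega>. X \<omega> \<and> \<omega> m = s} * g s)"
proof -
  have inner: "(\<Sum>s'\<in>states (Suc m). pmf (step_pmf f s) s' * g s') = g s" if s: "s \<in> states m" for s
  proof -
    have pos: "f (fst s) > 0" "f (snd s) > 0" using s f_pos by (auto simp: states_def)
    have sub: "{add_ball Bin1 s, add_ball Bin2 s} \<subseteq> states (Suc m)"
      using s by (cases s) (auto simp: states_def)
    have "(\<Sum>s'\<in>states (Suc m). pmf (step_pmf f s) s' * g s')
        = (\<Sum>s'\<in>{add_ball Bin1 s, add_ball Bin2 s}. pmf (step_pmf f s) s' * g s')"
    proof (rule sum.mono_neutral_right[OF finite_states sub], rule ballI)
      fix s' assume "s' \<in> states (Suc m) - {add_ball Bin1 s, add_ball Bin2 s}"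
      then have "s' \<noteq> add_ball i s" for i by (cases i) auto
      then show "pmf (step_pmf f s) s' * g s' = 0" by (simp add: pmf_step_zero)
    qed
    also have "\<dots> = f (fst s) / (f (fst s) + f (snd s)) * g (add_ball Bin1 s)
        + f (snd s) / (f (fst s) + f (snd s)) * g (add_ball Bin2 s)"
      using pmf_step[OF pos] by (subst sum.insert) auto
    also have "\<dots> = g s"
      using g[unfolded harmonic_def, rule_format, of "fst s" "snd s"] s
      by (cases s) (simp only: states_def mem_Collect_eq fst_conv snd_conv add_ball.simps)
    finally show ?thesis .
  qed
  have dec: "prob {\<omega>. X \<omega> \<and> \<omega> (Suc m) = s'} =
      (\<Sum>s\<in>states m. prob {\<omega>. X \<omega> \<and> \<omega> m = s} * pmf (step_pmf f s) s')" for s'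
  proof -
    have "determined_by_prefix (Suc m) (\<lambda>\<omega>. X \<omega> \<and> \<omega> (Suc m) = s')"
      using determined_by_prefix_mono[OF X, of "Suc m"] by (auto simp: determined_by_prefix_def)
    from total_prob[OF sets_determined[OF this], of m] show ?thesis
      unfolding markov[OF X, symmetric] by (simp add: conj_ac)
  qed
  have "(\<Sum>s'\<in>states (Suc m). prob {\<omega>. X \<omega> \<and> \<omega> (Suc m) = s'} * g s') =
      (\<Sum>s'\<in>states (Suc m). \<Sum>s\<in>states m. prob {\<omega>. X \<omega> \<and> \<omega> m = s} * (pmf (step_pmf f s) s' * g s'))"
    by (simp add: dec sum_distrib_right mult.assoc)
  also have "\<dots> = (\<Sum>s\<in>states m. prob {\<omega>. X \<omega> \<and> \<omega> m = s} *
      (\<Sum>s'\<in>states (Suc m). pmf (step_pmf f s) s' * g s'))"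
    by (subst sum.swap) (simp add: sum_distrib_left)
  also have "\<dots> = (\<Sum>s\<in>states m. prob {\<omega>. X \<omega> \<and> \<omega> m = s} * g s)"
    by (intro sum.cong refl) (simp add: inner)
  finally show ?thesis .
qed

lemma harmonic_steps:
  assumes X: "determined_by_prefix m X" and g: "harmonic g" and "m \<le> n"
  shows "(\<Sum>s\<in>states n. prob {\<omega>. X \<omega> \<and> \<omega> n = s} * g s)
    = (\<Sum>s\<in>states m. prob {\<omega>. X \<omega> \<and> \<omega> m = s} * g s)"
  using \<open>m \<le> n\<close>
proof (induction n rule: dec_induct)
  case (step n)
  then show ?case
    using harmonic_step[OF determined_by_prefix_mono[OF X] g, of n] by simp
qed simp

text \<open>Markov's inequality for the martingale started afresh from \<open>s0\<close> at time m:
  its mean over \<open>X\<close> is still \<open>prob {\<omega>. X \<omega>} * g s0\<close> at time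
  n, and it is at least c where \<open>B\<close> holds.\<close>

lemma harmonic_bound:
  assumes X: "determined_by_prefix m X" "\<And>\<omega>. X \<omega> \<Longrightarrow> \<omega> m = s0" and s0: "s0 \<in> states m"
    and g: "harmonic g" "\<And>s. s \<in> states n \<Longrightarrow> g s \<ge> 0"
    and "m \<le> n" and c: "\<And>s. s \<in> states n \<Longrightarrow> B s \<Longrightarrow> g s \<ge> c"
  shows "prob {\<omega>. X \<omega> \<and> B (\<omega> n)} * c \<le> prob {\<omega>. X \<omega>} * g s0"
proof -
  have ev: "{\<omega>. X \<omega> \<and> B (\<omega> n)} \<in> events"
    using determined_by_prefix_mono[OF X(1) \<open>m \<le> n\<close>]
    by (intro sets_determined[of n]) (auto simp: determined_by_prefix_def)
  have "prob {\<omega>. X \<omega> \<and> B (\<omega> n)} * c = (\<Sum>s\<in>states n. prob {\<omega>. (X \<omega> \<and> B (\<omega> n)) \<and> \<omega> n = s} * c)"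
    by (simp only: total_prob[OF ev, of n] sum_distrib_right)
  also have "\<dots> \<le> (\<Sum>s\<in>states n. prob {\<omega>. X \<omega> \<and> \<omega> n = s} * g s)"
  proof (rule sum_mono)
    fix s assume s: "s \<in> states n"
    show "prob {\<omega>. (X \<omega> \<and> B (\<omega> n)) \<and> \<omega> n = s} * c \<le> prob {\<omega>. X \<omega> \<and> \<omega> n = s} * g s"
    proof (cases "B s")
      case True
      then have "{\<omega>. (X \<omega> \<and> B (\<omega> n)) \<and> \<omega> n = s} = {\<omega>. X \<omega> \<and> \<omega> n = s}" by auto
      then show ?thesis using c[OF s True] by (simp add: mult_left_mono)
    next
      case False
      then have eq: "{\<omega>. (X \<omega> \<and> B (\<omega> n)) \<and> \<omega> n = s} = {}" by auto
      show ?thesis unfolding eq using g(2)[OF s] by simp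
    qed
  qed
  also have "\<dots> = (\<Sum>s\<in>states m. prob {\<omega>. X \<omega> \<and> \<omega> m = s} * g s)"
    by (rule harmonic_steps[OF X(1) g(1) \<open>m \<le> n\<close>])
  also have "\<dots> = (\<Sum>s\<in>{s0}. prob {\<omega>. X \<omega> \<and> \<omega> m = s} * g s)"
  proof (rule sum.mono_neutral_right)
    show "\<forall>s\<in>states m - {s0}. prob {\<omega>. X \<omega> \<and> \<omega> m = s} * g s = 0"
    proof
      fix s assume "s \<in> states m - {s0}"
      then have eq: "{\<omega>. X \<omega> \<and> \<omega> m = s} = {}" using X(2) by auto
      show "prob {\<omega>. X \<omega> \<and> \<omega> m = s} * g s = 0" unfolding eq by simp
    qed
  qed (use s0 finite_states in auto)
  also have "\<dots> = prob {\<omega>. X \<omega>} * g s0"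
    using X(2) by (simp cong: conj_cong)
  finally show ?thesis .
qed

text \<open>Chebyshev's inequality for the tail difference, centred at its value e just after the
  trailing bin reaches \<open>Suc a\<close>. There the square vanishes, so g starts at a sum of two
  \<open>tail2\<close> values, the variance bound.\<close>

lemma overtake_after_crossing:
  assumes s: "load i s = a" "load (other_bin i) s = k" "s \<in> states t"
    and a: "a \<ge> 1" and d: "0 < d" "d \<le> tail (Suc a) - tail k" and "Suc a \<le> k" and "Suc t \<le> n"
  shows "prob {\<omega>. (\<omega> t = s \<and> \<omega> (Suc t) = add_ball i s) \<and> load (other_bin i) (\<omega> n) \<le> load i (\<omega> n)}
    \<le> dens (x, y) * (2 * tail (Suc a) / f (Suc a)) / d\<^sup>2 * (1 / f k)"
proof -
  define e where "e = tail (Suc a) - tail k"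
  define g where "g s = (tail (load i s) - tail (load (other_bin i) s) - e)\<^sup>2 + (tail2 (fst s) + tail2 (snd s))" for s
  let ?X = "\<lambda>\<omega>. \<omega> t = s \<and> \<omega> (Suc t) = add_ball i s"
  have k: "k \<ge> 1" using \<open>Suc a \<le> k\<close> by simp
  have fpos: "f a > 0" "f k > 0" "f (Suc a) > 0" using f_pos a k by auto
  have fs: "f (fst s) * f (snd s) = f a * f k" "f (fst s) + f (snd s) = f a + f k"
    using s(1,2) by (cases i; simp)+
  have "prob {\<omega>. ?X \<omega> \<and> load (other_bin i) (\<omega> n) \<le> load i (\<omega> n)} * d\<^sup>2 \<le> prob {\<omega>. ?X \<omega>} * g (add_ball i s)"
  proof (rule harmonic_bound[where m = "Suc t" and B = "\<lambda>s. load (other_bin i) s \<le> load i s"])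
    show "determined_by_prefix (Suc t) ?X" by (auto simp: determined_by_prefix_def)
    show "add_ball i s \<in> states (Suc t)" using s(3) by (cases i; cases s) (auto simp: states_def)
    show "harmonic g" unfolding g_def by (rule harmonic_square)
    fix s' assume s': "s' \<in> states n"
    have pos: "tail2 (fst s') + tail2 (snd s') \<ge> 0"
      using s' tail2_nonneg by (simp add: states_def)
    then show "0 \<le> g s'" by (simp add: g_def)
    assume "load (other_bin i) s' \<le> load i s'"
    moreover have "load (other_bin i) s' \<ge> 1" using s' by (cases i) (auto simp: states_def)
    ultimately have "tail (load i s') \<le> tail (load (other_bin i) s')"
      by (intro tail_antimono)
    \<comment> \<open>Overtaking makes the tail difference nonpositive, hence at distance at least e
      \<ge> d from e. The sign is flipped so that squares of nonnegative numbers are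
      compared.\<close>
    then have "d\<^sup>2 \<le> (- (tail (load i s') - tail (load (other_bin i) s') - e))\<^sup>2"
      using d by (intro power_mono) (auto simp: e_def)
    then show "d\<^sup>2 \<le> g s'" using pos by (simp only: g_def power2_minus)
  qed (use \<open>Suc t \<le> n\<close> in auto)
  \<comment> \<open>The visit probability is the density times (f a + f k) / (f a f k), and the
    crossing ball contributes f a / (f a + f k). Only 1 / f k survives.\<close>
  moreover have "prob {\<omega>. ?X \<omega>} = dens s * (1 / f k)"
  proof -
    have "fst s + snd s - (x + y) = t" using s(3) by (simp add: states_def)
    moreover have "prob {\<omega>. ?X \<omega>} = prob {\<omega>. \<omega> t = s} * (f a / (f a + f k))"
      using transition[of t "\<lambda>_. True" s i] s(1) fs by (simp add: determined_by_prefix_def)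
    ultimately show ?thesis
      using fpos by (simp add: dens_def fs)
  qed
  moreover have "dens s \<le> dens (x, y)"
    using dens_le[of "fst s" "snd s"] by simp
  moreover have "g (add_ball i s) \<le> 2 * tail (Suc a) / f (Suc a)"
  proof -
    have "tail2 (fst (add_ball i s)) + tail2 (snd (add_ball i s)) = tail2 (Suc a) + tail2 k"
      using s(1,2) by (cases i; cases s) auto
    then have "g (add_ball i s) = tail2 (Suc a) + tail2 k"
      using s(1,2) by (simp add: g_def e_def)
    then show ?thesis
      using tail2_antimono[of "Suc a" k] tail2_le[of "Suc a"] \<open>Suc a \<le> k\<close> by simp
  qed
  moreover have "0 \<le> g (add_ball i s)"
    using tail2_nonneg s(3) unfolding g_def
    by (cases i; cases s) (auto simp: states_def intro!: add_nonneg_nonneg)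
  moreover have "0 \<le> dens (x, y)" using dens_nonneg x_ge y_ge by simp
  ultimately have "prob {\<omega>. ?X \<omega> \<and> load (other_bin i) (\<omega> n) \<le> load i (\<omega> n)} * d\<^sup>2
      \<le> (dens (x, y) * (1 / f k)) * (2 * tail (Suc a) / f (Suc a))"
    using fpos by (smt (verit, ccfv_SIG) divide_pos_pos mult_mono mult_nonneg_nonneg mult_right_mono)
  then have "prob {\<omega>. ?X \<omega> \<and> load (other_bin i) (\<omega> n) \<le> load i (\<omega> n)}
      \<le> (dens (x, y) * (1 / f k)) * (2 * tail (Suc a) / f (Suc a)) / d\<^sup>2"
    using d(1) by (subst pos_le_divide_eq) auto
  also have "\<dots> = dens (x, y) * (2 * tail (Suc a) / f (Suc a)) / d\<^sup>2 * (1 / f k)"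
    by simp
  finally show ?thesis .
qed

lemma crossing_time:
  fixes z :: "nat \<Rightarrow> nat"
  assumes "m \<le> n" "z m < a" "a \<le> z n" "\<And>t. z (Suc t) \<le> Suc (z t)"
  shows "\<exists>t\<in>{m..<n}. Suc (z t) = a \<and> z (Suc t) = a"
  using assms(1,3)
proof (induction n rule: dec_induct)
  case base
  then show ?case using assms(2) by simp
next
  case (step n)
  show ?case
  proof (cases "a \<le> z n")
    case True
    then show ?thesis using step by force
  next
    case False
    then show ?thesis using step assms(4)[of n] by (intro bexI[of _ n]) auto
  qed
qed

text \<open>To catch up, bin \<open>i\<close> must step from a to a + 1 at some time t \<ge> m, when
  the other bin holds x + y + t - a \<ge> b balls. So d = \<open>S1 f (Suc a) b\<close> serves for
  all t, and summing the factors 1 / f (x + y + t - a) over t gives at most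
  \<open>tail b\<close>.\<close>

lemma overtake_bound:
  assumes a: "a \<ge> 1" "2 * Suc a \<le> x + y + m" and "m \<le> n" and b: "b = x + y + m - a"
  shows "prob {\<omega>. load i (\<omega> m) < Suc a \<and> load (other_bin i) (\<omega> n) \<le> load i (\<omega> n)}
    \<le> dens (x, y) * (2 * tail (Suc a) / f (Suc a)) / (S1 f (Suc a) b)\<^sup>2 * tail b"
proof -
  \<comment> \<open>The total fixes the state at time t once bin \<open>i\<close> holds a balls, so
    crossings are indexed by time alone.\<close>
  define st where "st t = (case i of Bin1 \<Rightarrow> (a, x + y + t - a) | Bin2 \<Rightarrow> (x + y + t - a, a))" for t
  have st: "load i (st t) = a" "load (other_bin i) (st t) = x + y + t - a" for t
    by (cases i; simp add: st_def)+
  let ?E = "\<lambda>t \<omega>. (\<omega> t = st t \<and> \<omega> (Suc t) = add_ball i (st t)) \<and> load (other_bin i) (\<omega> n) \<le> load i (\<omega> n)"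
  let ?c = "dens (x, y) * (2 * tail (Suc a) / f (Suc a)) / (S1 f (Suc a) b)\<^sup>2"
  have ev: "{\<omega>. ?E t \<omega>} \<in> events" for t
    by (rule events_pred) measurable
  have UN: "{\<omega>. \<exists>t\<in>{m..<n}. ?E t \<omega>} = (\<Union>t\<in>{m..<n}. {\<omega>. ?E t \<omega>})"
    by blast
  have Spos: "S1 f (Suc a) b > 0"
    unfolding S1_def using a b f_pos by (intro sum_pos) auto
  have "prob {\<omega>. load i (\<omega> m) < Suc a \<and> load (other_bin i) (\<omega> n) \<le> load i (\<omega> n)}
      \<le> prob {\<omega>. \<exists>t\<in>{m..<n}. ?E t \<omega>}"
  proof (rule prob_mono_regular)
    fix \<omega> assume reg: "regular_path (x, y) \<omega>"
      and *: "load i (\<omega> m) < Suc a \<and> load (other_bin i) (\<omega> n) \<le> load i (\<omega> n)"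
    have step: "\<omega> (Suc t) = add_ball i (\<omega> t) \<or> \<omega> (Suc t) = add_ball (other_bin i) (\<omega> t)" for t
      using reg bin_exhaust2[of _ i] unfolding regular_path_def by metis
    have "load i (\<omega> (Suc t)) \<le> Suc (load i (\<omega> t))" for t
      using step[of t] by auto
    \<comment> \<open>At time n bin \<open>i\<close> holds at least half of the balls, and there are
      at least 2 (a + 1) of them.\<close>
    moreover have "Suc a \<le> load i (\<omega> n)"
      using regular_total[OF reg, of i n] conjunct2[OF *] a(2) \<open>m \<le> n\<close> by presburger
    ultimately have "\<exists>t\<in>{m..<n}. Suc (load i (\<omega> t)) = Suc a \<and> load i (\<omega> (Suc t)) = Suc a"
      using \<open>m \<le> n\<close> conjunct1[OF *] by (intro crossing_time)
    then obtain t where t: "t \<in> {m..<n}" "load i (\<omega> t) = a" "load i (\<omega> (Suc t)) = Suc a"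
      by blast
    have "\<omega> t = st t"
      using regular_total[OF reg, of i t] t(2) by (subst state_eq_iff[of _ _ i]) (auto simp: st)
    moreover have "\<omega> (Suc t) = add_ball i (\<omega> t)"
      using step[of t] t by auto
    ultimately show "\<exists>t\<in>{m..<n}. ?E t \<omega>" using t(1) * by auto
  next
    show "{\<omega>. \<exists>t\<in>{m..<n}. ?E t \<omega>} \<in> events"
      unfolding UN using ev by (intro sets.finite_UN) auto
  qed
  also have "\<dots> \<le> (\<Sum>t\<in>{m..<n}. prob {\<omega>. ?E t \<omega>})"
    unfolding UN by (rule finite_measure_subadditive_finite) (use ev in auto)
  also have "\<dots> \<le> (\<Sum>t\<in>{m..<n}. ?c * (1 / f (x + y + t - a)))"
  proof (rule sum_mono)
    fix t assume t: "t \<in> {m..<n}"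
    then have bt: "b \<le> x + y + t - a" unfolding b by (intro diff_le_mono) simp
    have ab: "Suc a \<le> b" using a b by simp
    have tot: "a + (x + y + t - a) = x + y + t" "x + y + t - a \<ge> 1" using ab bt by linarith+
    show "prob {\<omega>. ?E t \<omega>} \<le> ?c * (1 / f (x + y + t - a))"
    proof (rule overtake_after_crossing[OF st _ a(1) Spos])
      show "st t \<in> states t"
        using a(1) tot by (cases i) (simp_all add: st_def states_def add.commute)
      show "S1 f (Suc a) b \<le> tail (Suc a) - tail (x + y + t - a)"
        using tail_split[OF ab] tail_antimono[OF _ bt] ab by simp
      show "Suc a \<le> x + y + t - a" "Suc t \<le> n" using t ab bt by simp_all
    qed
  qed
  also have "\<dots> = ?c * (\<Sum>t\<in>{m..<n}. 1 / f (x + y + t - a))"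
    by (simp add: sum_distrib_left)
  also have "\<dots> \<le> ?c * tail b"
  proof (rule mult_left_mono)
    have "(\<Sum>t\<in>{m..<n}. 1 / f (x + y + t - a)) = S1 f b (b + (n - m))"
      unfolding S1_def
      by (rule sum.reindex_bij_witness[of _ "\<lambda>k. k - b + m" "\<lambda>t. t - m + b"])
        (use a b in \<open>auto simp: add_ac\<close>)
    also have "\<dots> \<le> tail b"
    proof -
      have "b \<ge> 1" using a b by simp
      then show ?thesis
        using tail_split[of b "b + (n - m)"] tail_pos[of "b + (n - m)"] by simp
    qed
    finally show "(\<Sum>t\<in>{m..<n}. 1 / f (x + y + t - a)) \<le> tail b" .
    show "0 \<le> ?c"
      using dens_nonneg[OF x_ge y_ge] tail_pos[of "Suc a"] f_pos[of "Suc a"]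
      by (intro divide_nonneg_nonneg mult_nonneg_nonneg) auto
  qed
  finally show ?thesis .
qed

end

section \<open>The losing bin\<close>

lemma loses_unique: "loses i \<omega> \<Longrightarrow> loses j \<omega> \<Longrightarrow> i = j"
proof -
  assume "loses i \<omega>" "loses j \<omega>"
  then have "\<forall>\<^sub>F m in sequentially. add_ball (other_bin i) (\<omega> m) = add_ball (other_bin j) (\<omega> m)"
    unfolding loses_def by eventually_elim metis
  then have "other_bin i = other_bin j"
    by (auto simp: eventually_sequentially)
  then show "i = j" by (metis other_other)
qed

lemma losing_bin_eq: "loses i \<omega> \<Longrightarrow> losing_bin \<omega> = i"
  unfolding losing_bin_def using loses_unique by blast

lemma loses_loads:
  assumes "loses i \<omega>"
  obtains N where "\<And>k. load i (\<omega> (N + k)) = load i (\<omega> N)"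
    "\<And>k. load (other_bin i) (\<omega> (N + k)) = load (other_bin i) (\<omega> N) + k"
proof -
  obtain N where N: "\<And>m. m \<ge> N \<Longrightarrow> \<omega> (Suc m) = add_ball (other_bin i) (\<omega> m)"
    using assms unfolding loses_def eventually_sequentially by blast
  have "load i (\<omega> (N + k)) = load i (\<omega> N) \<and>
      load (other_bin i) (\<omega> (N + k)) = load (other_bin i) (\<omega> N) + k" for k
    by (induction k) (simp_all add: N)
  then show ?thesis using that by blast
qed

lemma loses_eventually_le:
  assumes "loses (other_bin i) \<omega>"
  shows "\<exists>N. \<forall>n\<ge>N. load (other_bin i) (\<omega> n) \<le> load i (\<omega> n)"
proof -
  obtain N where N: "\<And>k. load (other_bin i) (\<omega> (N + k)) = load (other_bin i) (\<omega> N)"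
    "\<And>k. load i (\<omega> (N + k)) = load i (\<omega> N) + k"
    using loses_loads[OF assms] by (metis other_other)
  have "load (other_bin i) (\<omega> n) \<le> load i (\<omega> n)" if "n \<ge> N + load (other_bin i) (\<omega> N)" for n
    using N[of "n - N"] that by simp
  then show ?thesis by blast
qed

text \<open>At time 2 a one bin is below a and the other has reached it for good, so the first bin
  stays below a forever. Once its bounded load attains its maximum, every further ball goes to the
  other bin.\<close>

lemma regular_path_loses:
  assumes reg: "regular_path u \<omega>" and a: "\<And>m. \<exists>i. load i (\<omega> m) < a"
  shows "\<exists>i. loses i \<omega>"
proof -
  obtain i where i: "load i (\<omega> (2 * a)) < a" using a by blast
  have "load (other_bin i) (\<omega> (2 * a)) \<ge> a"
    using i regular_path_total[OF reg, of i "2 * a"] by simp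
  then have "load (other_bin i) (\<omega> n) \<ge> a" if "n \<ge> 2 * a" for n
    using regular_path_mono[OF reg that, of "other_bin i"] by simp
  then have "load i (\<omega> n) < a" if "n \<ge> 2 * a" for n
    using a[of n] bin_exhaust2[of _ i] that by (metis not_le)
  then obtain m where m: "m \<ge> 2 * a" "\<And>n. n \<ge> 2 * a \<Longrightarrow> load i (\<omega> n) \<le> load i (\<omega> m)"
    using ex_has_greatest_nat[of "\<lambda>n. n \<ge> 2 * a" "2 * a" "\<lambda>n. load i (\<omega> n)" a] by auto
  have "\<omega> (Suc n) = add_ball (other_bin i) (\<omega> n)" if n: "n \<ge> m" for n
  proof -
    have "load i (\<omega> (Suc n)) \<le> load i (\<omega> n)"
      using m(2)[of "Suc n"] m(1) n regular_path_mono[OF reg n, of i] by linarith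
    moreover obtain j where j: "\<omega> (Suc n) = add_ball j (\<omega> n)"
      using reg unfolding regular_path_def by blast
    ultimately show ?thesis
      using bin_exhaust2[of j i] by auto
  qed
  then show ?thesis
    unfolding loses_def eventually_sequentially by blast
qed

text \<open>This trades a limit for an event about loads at one time: loads never decrease, and the
  winning bin grows without bound while the loser rests at its final load.\<close>

lemma losing_number_greater_iff:
  assumes reg: "regular_path u \<omega>" and "loses i \<omega>"
  shows "losing_number \<omega> > n \<longleftrightarrow> (\<exists>m. \<forall>j. Suc n \<le> load j (\<omega> m))"
proof -
  obtain N where N: "\<And>k. load i (\<omega> (N + k)) = load i (\<omega> N)"
    "\<And>k. load (other_bin i) (\<omega> (N + k)) = load (other_bin i) (\<omega> N) + k"
    using loses_loads[OF assms(2)] by blast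
  have "(\<lambda>m. load i (\<omega> m)) \<longlonglongrightarrow> load i (\<omega> N)"
    using N(1) unfolding tendsto_discrete eventually_sequentially by (metis le_Suc_ex)
  then have L: "losing_number \<omega> = load i (\<omega> N)"
    unfolding losing_number_def losing_bin_eq[OF assms(2)] by (rule limI)
  show ?thesis
  proof
    assume "losing_number \<omega> > n"
    then have "load i (\<omega> (N + Suc n)) \<ge> Suc n" "load (other_bin i) (\<omega> (N + Suc n)) \<ge> Suc n"
      using N[of "Suc n"] L by simp_all
    then show "\<exists>m. \<forall>j. Suc n \<le> load j (\<omega> m)"
      using bin_exhaust2[of _ i] by metis
  next
    assume "\<exists>m. \<forall>j. Suc n \<le> load j (\<omega> m)"
    then obtain m where "Suc n \<le> load i (\<omega> m)" by blast
    also have "\<dots> \<le> load i (\<omega> (N + m))"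
      by (rule regular_path_mono[OF reg]) simp
    finally show "losing_number \<omega> > n" using N(1)[of m] L by simp
  qed
qed

section \<open>Measurability of the losing bin and the losing number\<close>

lemma losing_bin_cases:
  "losing_bin \<omega> = (if loses Bin1 \<omega> then Bin1 else if loses Bin2 \<omega> then Bin2 else (THE i. False))"
proof (cases "\<exists>i. loses i \<omega>")
  case True
  then show ?thesis using losing_bin_eq loses_unique by (metis bin.exhaust)
next
  case False
  then show ?thesis by (simp add: losing_bin_def)
qed

lemma measurable_loses [measurable]: "Measurable.pred (bins_process f u) (loses i)"
  unfolding loses_def eventually_sequentially by measurable

lemma measurable_losing_bin [measurable]:
  "losing_bin \<in> measurable (bins_process f u) (count_space UNIV)"
  unfolding losing_bin_cases[abs_def] by measurable

lemma measurable_losing_load [measurable]: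
  "(\<lambda>\<omega>. load (losing_bin \<omega>) (\<omega> m)) \<in> measurable (bins_process f u) (count_space UNIV)"
proof (rule measurable_compose_countable[where f = "\<lambda>s \<omega>. load (losing_bin \<omega>) s", OF _ measurable_state])
  show "(\<lambda>\<omega>. load (losing_bin \<omega>) s) \<in> measurable (bins_process f u) (count_space UNIV)" for s
    by (rule measurable_compose[OF measurable_losing_bin]) simp
qed

lemma measurable_loser_has_more_than [measurable]:
  "Measurable.pred (bins_process f u) (loser_has_more_than \<alpha> n)"
  unfolding loser_has_more_than_def by measurable

text \<open>Convergence of natural numbers means being eventually constant, so \<open>lim\<close> is
  expressed by countable quantifiers. Without convergence, \<open>lim\<close> takes the default
  value \<open>THE L. False\<close>.\<close>

lemma lim_nat_greater_iff:
  fixes X :: "nat \<Rightarrow> nat"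
  shows "n < lim X \<longleftrightarrow> (\<exists>L. n < L \<and> (\<exists>N. \<forall>m\<ge>N. X m = L)) \<or>
    (\<forall>L. \<not> (\<exists>N. \<forall>m\<ge>N. X m = L)) \<and> n < (THE L. False)"
proof -
  have conv: "(\<exists>N. \<forall>m\<ge>N. X m = L) \<longleftrightarrow> X \<longlonglongrightarrow> L" for L
    unfolding tendsto_discrete eventually_sequentially ..
  show ?thesis
    unfolding conv
  proof (cases "\<exists>L. X \<longlonglongrightarrow> L")
    case True
    then obtain L where L: "X \<longlonglongrightarrow> L" by blast
    have "X \<longlonglongrightarrow> L' \<longleftrightarrow> L' = L" for L'
      using L LIMSEQ_unique[OF L] by blast
    then show "n < lim X \<longleftrightarrow> (\<exists>L. n < L \<and> X \<longlonglongrightarrow> L) \<or> (\<forall>L. \<not> X \<longlonglongrightarrow> L) \<and> n < (THE L. False)"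
      using limI[OF L] by auto
  next
    case False
    then have "X \<longlonglongrightarrow> L \<longleftrightarrow> False" for L by blast
    then show "n < lim X \<longleftrightarrow> (\<exists>L. n < L \<and> X \<longlonglongrightarrow> L) \<or> (\<forall>L. \<not> X \<longlonglongrightarrow> L) \<and> n < (THE L. False)"
      unfolding lim_def by simp
  qed
qed

lemma measurable_losing_number [measurable]:
  "Measurable.pred (bins_process f u) (\<lambda>\<omega>. n < losing_number \<omega>)"
  unfolding losing_number_def lim_nat_greater_iff by measurable

section \<open>Limits in time and existence of a loser\<close>

context bins_chain
begin

lemma events_loads_ge: "{\<omega>. \<forall>i. a \<le> load i (\<omega> m)} \<in> events"
proof -
  have "(\<forall>i. a \<le> load i s) \<longleftrightarrow> a \<le> fst s \<and> a \<le> snd s" for s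
    by (metis bin.exhaust load.simps)
  then show ?thesis
    by (simp only:) (rule events_pred, measurable)
qed

text \<open>Fatou's lemma for events: \<open>A\<close> lies in the increasing union over N of the
  events that \<open>B n\<close> holds for all n \<ge> N, each of probability at most c for N \<ge>
  m.\<close>

lemma prob_le_of_eventually:
  fixes m :: nat
  assumes A: "{\<omega>. A \<omega>} \<in> events" and B: "\<And>n. {\<omega>. B n \<omega>} \<in> events"
    and AB: "\<And>\<omega>. A \<omega> \<Longrightarrow> \<exists>N. \<forall>n\<ge>N. B n \<omega>"
    and le: "\<And>n. n \<ge> m \<Longrightarrow> prob {\<omega>. B n \<omega>} \<le> c"
  shows "prob {\<omega>. A \<omega>} \<le> c"
proof -
  let ?C = "\<lambda>N. \<Inter>k. {\<omega>. B (N + k) \<omega>}"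
  have C: "?C N \<in> events" for N
    using B by (intro sets.countable_INT) auto
  have "incseq ?C"
  proof (rule incseq_SucI, rule subsetI)
    fix N \<omega> assume "\<omega> \<in> ?C N"
    then have "B (N + Suc k) \<omega>" for k by blast
    then show "\<omega> \<in> ?C (Suc N)" by simp
  qed
  then have "(\<lambda>N. prob (?C N)) \<longlonglongrightarrow> prob (\<Union>N. ?C N)"
    using C by (intro finite_Lim_measure_incseq) auto
  moreover have "prob (?C N) \<le> c" if "N \<ge> m" for N
  proof -
    have "?C N \<subseteq> {\<omega>. B (N + 0) \<omega>}" by blast
    then have "prob (?C N) \<le> prob {\<omega>. B N \<omega>}"
      using B by (intro finite_measure_mono) auto
    then show ?thesis using le[OF that] by simp
  qed
  ultimately have "prob (\<Union>N. ?C N) \<le> c"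
    by (intro LIMSEQ_le_const2) auto
  moreover have "{\<omega>. A \<omega>} \<subseteq> (\<Union>N. ?C N)"
  proof
    fix \<omega> assume "\<omega> \<in> {\<omega>. A \<omega>}"
    then obtain N where "\<forall>n\<ge>N. B n \<omega>" using AB by blast
    then have "\<omega> \<in> ?C N" by simp
    then show "\<omega> \<in> (\<Union>N. ?C N)" by blast
  qed
  then have "prob {\<omega>. A \<omega>} \<le> prob (\<Union>N. ?C N)"
    using C by (intro finite_measure_mono sets.countable_UN) auto
  ultimately show ?thesis by simp
qed

text \<open>If the other bin loses, bin \<open>i\<close> is level or ahead at all late times, and
  \<open>overtake_bound\<close> is uniform in the final time.\<close>

lemma overtake_bound_loses:
  assumes "a \<ge> 1" "2 * Suc a \<le> x + y + m" and "b = x + y + m - a"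
  shows "prob {\<omega>. load i (\<omega> m) < Suc a \<and> loses (other_bin i) \<omega>}
    \<le> dens (x, y) * (2 * tail (Suc a) / f (Suc a)) / (S1 f (Suc a) b)\<^sup>2 * tail b"
proof (rule prob_le_of_eventually)
  show "prob {\<omega>. load i (\<omega> m) < Suc a \<and> load (other_bin i) (\<omega> n) \<le> load i (\<omega> n)}
    \<le> dens (x, y) * (2 * tail (Suc a) / f (Suc a)) / (S1 f (Suc a) b)\<^sup>2 * tail b" if "n \<ge> m" for n
    by (rule overtake_bound[OF assms(1,2) that assms(3)])
  show "\<exists>N. \<forall>n\<ge>N. load i (\<omega> m) < Suc a \<and> load (other_bin i) (\<omega> n) \<le> load i (\<omega> n)"
    if "load i (\<omega> m) < Suc a \<and> loses (other_bin i) \<omega>" for \<omega>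
    using loses_eventually_le[of i \<omega>] that by blast
qed (rule events_pred, measurable)+

lemma prob_both_eventually_ge:
  "(\<lambda>m. prob {\<omega>. \<forall>i. a \<le> load i (\<omega> m)}) \<longlonglongrightarrow> prob {\<omega>. \<exists>m. \<forall>i. a \<le> load i (\<omega> m)}"
proof -
  \<comment> \<open>Unions over times up to m increase with m on every path. On regular paths they
    agree with the event at time m.\<close>
  let ?B = "\<lambda>m::nat. \<Union>k\<in>{..m}. {\<omega>::nat \<Rightarrow> nat \<times> nat. \<forall>i. a \<le> load i (\<omega> k)}"
  have B: "?B m \<in> events" for m
    by (intro sets.finite_UN events_loads_ge) auto
  have "(\<lambda>m. prob (?B m)) \<longlonglongrightarrow> prob (\<Union>m. ?B m)"
    using B by (intro finite_Lim_measure_incseq) (auto simp: incseq_def intro: order_trans)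
  moreover have "(\<Union>m. ?B m) = {\<omega>::nat \<Rightarrow> nat \<times> nat. \<exists>m. \<forall>i. a \<le> load i (\<omega> m)}"
    by auto
  moreover have "prob (?B m) = prob {\<omega>. \<forall>i. a \<le> load i (\<omega> m)}" for m
  proof -
    have eq: "?B m = {\<omega>::nat \<Rightarrow> nat \<times> nat. \<exists>k\<le>m. \<forall>i. a \<le> load i (\<omega> k)}"
      by auto
    show ?thesis
      unfolding eq
    proof (rule prob_cong_regular)
      fix \<omega> assume "regular_path (x, y) \<omega>"
      from regular_path_mono[OF this]
      show "(\<exists>k\<le>m. \<forall>i. a \<le> load i (\<omega> k)) \<longleftrightarrow> (\<forall>i. a \<le> load i (\<omega> m))"
        by (meson order_refl order_trans)
    qed (use B[of m] events_loads_ge in \<open>simp_all add: eq\<close>)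
  qed
  ultimately show ?thesis by simp
qed

lemma prob_both_eventually_ge_approx:
  assumes "a \<ge> 1" "\<And>k k'. k \<ge> a \<Longrightarrow> k' \<ge> a \<Longrightarrow> \<bar>dens (k, k') - l\<bar> \<le> e"
  shows "\<bar>prob {\<omega>. \<exists>m. \<forall>i. a \<le> load i (\<omega> m)} - 2 * l * tail a\<bar> \<le> 2 * e * tail a"
proof -
  have S: "(\<lambda>m. S1 f a (Suc (x + y + m) - a)) \<longlonglongrightarrow> tail a"
  proof -
    have "filterlim (\<lambda>m. Suc (x + y + m) - a) at_top sequentially"
      unfolding filterlim_at_top
    proof
      fix Z
      show "\<forall>\<^sub>F m in sequentially. Z \<le> Suc (x + y + m) - a"
        using eventually_ge_at_top[of "Z + a"] by eventually_elim simp
    qed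
    then have "(\<lambda>m. tail a - tail (Suc (x + y + m) - a)) \<longlonglongrightarrow> tail a - 0"
      by (intro tendsto_intros filterlim_compose[OF tail_tendsto_0])
    moreover have "\<forall>\<^sub>F m in sequentially. tail a - tail (Suc (x + y + m) - a) = S1 f a (Suc (x + y + m) - a)"
      using eventually_ge_at_top[of "2 * a"]
    proof eventually_elim
      case (elim m)
      then show ?case using tail_split[of a "Suc (x + y + m) - a"] by simp
    qed
    ultimately show ?thesis
      by (simp add: Lim_transform_eventually)
  qed
  show ?thesis
  proof (rule LIMSEQ_le)
    show "(\<lambda>m. \<bar>prob {\<omega>. \<forall>i. a \<le> load i (\<omega> m)} - 2 * l * S1 f a (Suc (x + y + m) - a)\<bar>)
        \<longlonglongrightarrow> \<bar>prob {\<omega>. \<exists>m. \<forall>i. a \<le> load i (\<omega> m)} - 2 * l * tail a\<bar>"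
      by (intro tendsto_intros prob_both_eventually_ge S)
    show "(\<lambda>m. 2 * e * S1 f a (Suc (x + y + m) - a)) \<longlonglongrightarrow> 2 * e * tail a"
      by (intro tendsto_intros S)
    show "\<exists>N. \<forall>m\<ge>N. \<bar>prob {\<omega>. \<forall>i. a \<le> load i (\<omega> m)} - 2 * l * S1 f a (Suc (x + y + m) - a)\<bar>
        \<le> 2 * e * S1 f a (Suc (x + y + m) - a)"
      using prob_both_ge_approx[OF assms] by blast
  qed
qed

text \<open>The probability that both bins ever reach a is at most (2 l + 2) \<open>tail a\<close>,
  which tends to 0. So almost surely some level is never reached by both, and the pathwise criterion
  applies.\<close>

lemma AE_loses: "AE \<omega> in P. \<exists>i. loses i \<omega>"
proof -
  let ?E = "\<lambda>a. {\<omega>::nat \<Rightarrow> nat \<times> nat. \<exists>m. \<forall>i. a \<le> load i (\<omega> m)}"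
  have E: "?E a \<in> events" for a
  proof -
    have "?E a = (\<Union>m. {\<omega>::nat \<Rightarrow> nat \<times> nat. \<forall>i. a \<le> load i (\<omega> m)})" by auto
    then show ?thesis using events_loads_ge by (simp add: sets.countable_UN)
  qed
  obtain l where "\<forall>e>0. \<exists>n. \<forall>a\<ge>n. \<forall>b\<ge>n. \<bar>dens (a, b) - l\<bar> < e"
    using dens_limit by blast
  then obtain n where n: "\<And>a b. a \<ge> n \<Longrightarrow> b \<ge> n \<Longrightarrow> \<bar>dens (a, b) - l\<bar> < 1"
    using zero_less_one by blast
  have I: "(\<Inter>a. ?E a) \<in> events"
    using E by (intro sets.countable_INT) auto
  have "prob (\<Inter>a. ?E a) \<le> (2 * l + 2) * tail a" if a: "a \<ge> max 1 n" for a
  proof -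
    have "prob (\<Inter>a. ?E a) \<le> prob (?E a)"
      by (rule finite_measure_mono[OF _ E]) blast
    also have "\<dots> \<le> (2 * l + 2) * tail a"
      using prob_both_eventually_ge_approx[of a l 1] n a by (force simp: algebra_simps less_imp_le)
    finally show ?thesis .
  qed
  moreover have "(\<lambda>a. (2 * l + 2) * tail a) \<longlonglongrightarrow> (2 * l + 2) * 0"
    by (intro tendsto_intros tail_tendsto_0)
  ultimately have "prob (\<Inter>a. ?E a) \<le> (2 * l + 2) * 0"
    by (intro LIMSEQ_le_const) blast+
  then have "prob (\<Inter>a. ?E a) = 0"
    by (simp add: measure_le_0_iff)
  then have "AE \<omega> in P. \<omega> \<notin> (\<Inter>a. ?E a)"
    by (intro AE_not_in null_setsI I) (simp only: emeasure_eq_measure ennreal_0)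
  with AE_regular_path[of "(x, y)" f] show ?thesis
  proof eventually_elim
    case (elim \<omega>)
    then obtain a where "\<And>m. \<exists>i. load i (\<omega> m) < a"
      by (auto simp: not_le)
    then show ?case using regular_path_loses[OF elim(1)] by blast
  qed
qed

end

section \<open>Asymptotics\<close>

lemma ratio_tendsto_of_relative_error:
  fixes u v :: "nat \<Rightarrow> real"
  assumes "K \<ge> 0" and "\<And>e. 0 < e \<Longrightarrow> e < 1 \<Longrightarrow> \<forall>\<^sub>F n in sequentially. v n > 0 \<and> \<bar>u n - c * v n\<bar> \<le> K * e * v n"
  shows "(\<lambda>n. u n / v n) \<longlonglongrightarrow> c"
proof (rule tendstoI)
  fix r :: real assume "r > 0"
  \<comment> \<open>This gives K e \<le> r / 2 together with e < 1; the denominator has K + 1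
    because K may be 0.\<close>
  define e where "e = min (1 / 2) (r / (2 * (K + 1)))"
  have e: "0 < e" "e < 1" using \<open>r > 0\<close> assms(1) by (auto simp: e_def)
  have "K * e \<le> (K + 1) * (r / (2 * (K + 1)))"
    using assms(1) e(1) by (intro mult_mono) (auto simp: e_def)
  also have "\<dots> = r / 2" using assms(1) by (simp add: field_simps)
  finally have Ke: "K * e < r" using \<open>r > 0\<close> by simp
  show "\<forall>\<^sub>F n in sequentially. dist (u n / v n) c < r"
    using assms(2)[OF e]
  proof eventually_elim
    case (elim n)
    have "u n / v n - c = (u n - c * v n) / v n"
      using elim by (simp add: field_simps)
    then have "\<bar>u n / v n - c\<bar> = \<bar>u n - c * v n\<bar> / v n"
      using elim by (simp add: abs_divide)
    also have "\<dots> \<le> K * e"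
      using elim by (simp add: pos_divide_le_eq)
    finally show ?case using Ke by (simp add: dist_real_def)
  qed
qed

lemma asymp_equiv_of_ratio:
  fixes u v :: "nat \<Rightarrow> real"
  assumes "(\<lambda>n. u n / v n) \<longlonglongrightarrow> c" "c \<noteq> 0"
  shows "u \<sim>[sequentially] (\<lambda>n. c * v n)"
proof (rule asymp_equivI')
  have "(\<lambda>n. u n / v n / c) \<longlonglongrightarrow> c / c"
    by (intro tendsto_intros assms)
  then show "(\<lambda>n. u n / (c * v n)) \<longlonglongrightarrow> 1"
    using assms(2) by (simp add: mult.commute)
qed

context tame_feedback
begin

lemma inverse_le_S1:
  assumes "e > 0"
  obtains D :: nat where "\<forall>\<^sub>F a in sequentially. \<forall>b\<ge>a + D. 1 / f a \<le> e * S1 f a b"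
proof -
  obtain D :: nat where D: "2 / e \<le> real D" using real_arch_simple by blast
  have "\<forall>\<^sub>F a in sequentially. \<forall>b\<ge>a + D. 1 / f a \<le> e * S1 f a b"
    using weight_times_S1[of D] eventually_ge_at_top[of 1]
  proof eventually_elim
    case (elim a)
    have "1 / f a \<le> e * S1 f a b" if "b \<ge> a + D" for b
    proof -
      have "2 / e \<le> 2 * (f a * S1 f a b)" using D elim(1) that by (meson order_trans)
      then show ?thesis
        using f_pos[OF elim(2)] assms by (simp add: field_simps)
    qed
    then show ?case by blast
  qed
  then show ?thesis by (rule that)
qed

lemma inverse_le_tail:
  assumes "e > 0"
  shows "\<forall>\<^sub>F a in sequentially. 1 / f a \<le> e * tail a"
proof -
  obtain D :: nat where "\<forall>\<^sub>F a in sequentially. \<forall>b\<ge>a + D. 1 / f a \<le> e * S1 f a b"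
    using inverse_le_S1[OF assms] .
  then show ?thesis
    using eventually_ge_at_top[of 1]
  proof eventually_elim
    case (elim a)
    have "S1 f a (a + D) \<le> tail a"
      using tail_split[of a "a + D"] tail_pos[of "a + D"] elim(2) by simp
    then show ?case
      using elim(1) assms by (meson le_refl mult_left_mono less_imp_le order_trans)
  qed
qed

end

section \<open>The two asymptotic equivalences\<close>

context bins_chain
begin

text \<open>The strict inequality means that both bins reach \<open>Suc n\<close>, which produces
  \<open>tail (Suc n)\<close>. It differs from \<open>tail n\<close> by the single negligible term 1
  / f n.\<close>

lemma losing_number_asymp:
  assumes l: "l > 0" "\<And>e. e > 0 \<Longrightarrow> \<exists>n. \<forall>a\<ge>n. \<forall>b\<ge>n. \<bar>dens (a, b) - l\<bar> < e"
  shows "(\<lambda>n. prob {\<omega>. losing_number \<omega> > n}) \<sim>[sequentially] (\<lambda>n. 2 * l * tail n)"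
proof (rule asymp_equiv_of_ratio[OF ratio_tendsto_of_relative_error])
  fix e :: real assume e: "0 < e" "e < 1"
  obtain N where N: "\<And>a b. a \<ge> N \<Longrightarrow> b \<ge> N \<Longrightarrow> \<bar>dens (a, b) - l\<bar> \<le> e"
    using l(2)[OF e(1)] by (meson less_imp_le)
  show "\<forall>\<^sub>F n in sequentially. tail n > 0 \<and>
      \<bar>prob {\<omega>. losing_number \<omega> > n} - 2 * l * tail n\<bar> \<le> (2 + 2 * l) * e * tail n"
    using inverse_le_tail[OF e(1)] eventually_ge_at_top[of "max 1 N"]
  proof eventually_elim
    case (elim n)
    have pos: "tail n > 0" using elim by (intro tail_pos) simp
    have "prob {\<omega>. losing_number \<omega> > n} = prob {\<omega>. \<exists>m. \<forall>i. Suc n \<le> load i (\<omega> m)}"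
    proof (rule finite_measure_eq_AE)
      show "AE \<omega> in P. \<omega> \<in> {\<omega>. losing_number \<omega> > n} \<longleftrightarrow> \<omega> \<in> {\<omega>. \<exists>m. \<forall>i. Suc n \<le> load i (\<omega> m)}"
        using AE_regular_path[of "(x, y)" f] AE_loses
      proof eventually_elim
        case (elim \<omega>)
        then obtain i where "loses i \<omega>" by blast
        then show ?case using losing_number_greater_iff[OF elim(1), of i n] by simp
      qed
      show "{\<omega>. losing_number \<omega> > n} \<in> events"
        by (rule events_pred) measurable
      have "{\<omega>::nat \<Rightarrow> nat \<times> nat. \<exists>m. \<forall>i. Suc n \<le> load i (\<omega> m)} = (\<Union>m. {\<omega>. \<forall>i. Suc n \<le> load i (\<omega> m)})"
        by auto
      then show "{\<omega>. \<exists>m. \<forall>i. Suc n \<le> load i (\<omega> m)} \<in> events"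
        using events_loads_ge by (simp add: sets.countable_UN)
    qed
    then have "\<bar>prob {\<omega>. losing_number \<omega> > n} - 2 * l * tail (Suc n)\<bar> \<le> 2 * e * tail (Suc n)"
      using prob_both_eventually_ge_approx[of "Suc n" l e] N elim(2) by simp
    moreover have "tail n = 1 / f n + tail (Suc n)" "1 / f n \<ge> 0"
      using tail_rec[of n] f_pos[of n] elim(2) by auto
    moreover have "2 * l * (1 / f n) \<le> 2 * l * (e * tail n)"
      using elim(1) l(1) by (intro mult_left_mono) auto
    moreover have "2 * l * (1 / f n) \<ge> 0"
      using l(1) calculation(3) by simp
    moreover have "2 * e * tail (Suc n) \<le> 2 * e * tail n"
      using calculation(2,3) e(1) by (intro mult_left_mono) auto
    ultimately have "\<bar>prob {\<omega>. losing_number \<omega> > n} - 2 * l * tail n\<bar> \<le> 2 * e * tail n + 2 * l * (e * tail n)"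
      by (simp add: distrib_left abs_le_iff)
    then show ?case using pos by (simp add: algebra_simps)
  qed
qed (use l(1) in auto)

text \<open>If both bins hold a balls, so does the loser. Conversely, if the loser holds a balls and
  the winner does not, the winner must still overtake, and the overtaking bound applies to either
  choice of winner.\<close>

lemma loser_has_more_than_bounds:
  fixes \<alpha> :: real and m :: nat
  assumes n_def: "n = x + y + m" and a_def: "a = nat \<lceil>\<alpha> * real n\<rceil>"
    and a: "a = Suc a'" "a' \<ge> 1" "2 * a \<le> n"
    and near: "\<And>k k'. k \<ge> a \<Longrightarrow> k' \<ge> a \<Longrightarrow> \<bar>dens (k, k') - l\<bar> \<le> e"
  defines "S \<equiv> S1 f a (Suc n - a)"
  shows "\<bar>prob {\<omega>. loser_has_more_than \<alpha> n \<omega>} - 2 * l * S\<bar>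
    \<le> 2 * e * S + 2 * (dens (x, y) * (2 * tail a / f a) / S\<^sup>2 * tail (Suc n - a))"
proof -
  let ?L = "{\<omega>. loser_has_more_than \<alpha> n \<omega>}"
  let ?B = "{\<omega>. \<forall>i. a \<le> load i (\<omega> m)}"
  \<comment> \<open>Bin \<open>i\<close> is below the threshold at time m and wins
    nevertheless.\<close>
  let ?O = "\<lambda>i. {\<omega>. load i (\<omega> m) < a \<and> loses (other_bin i) \<omega>}"
  have L: "?L \<in> events" and O: "?O i \<in> events" for i
    by (rule events_pred, measurable)+
  have iff: "loser_has_more_than \<alpha> n \<omega> \<longleftrightarrow> a \<le> load i (\<omega> m)"
    if reg: "regular_path (x, y) \<omega>" and i: "loses i \<omega>" for \<omega> i
  proof -
    have "load Bin1 (\<omega> k) + load Bin2 (\<omega> k) = n \<longleftrightarrow> k = m" for k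
      using regular_total[OF reg, of Bin1 k] by (auto simp: n_def)
    then have "loser_has_more_than \<alpha> n \<omega> \<longleftrightarrow> \<alpha> * real n \<le> real (load i (\<omega> m))"
      unfolding loser_has_more_than_def losing_bin_eq[OF i] by simp
    also have "\<dots> \<longleftrightarrow> a \<le> load i (\<omega> m)"
      unfolding a_def by linarith
    finally show ?thesis .
  qed
  have "prob ?B \<le> prob ?L"
  proof (rule finite_measure_mono_AE[OF _ L])
    show "AE \<omega> in P. \<omega> \<in> ?B \<longrightarrow> \<omega> \<in> ?L"
      using AE_regular_path[of "(x, y)" f] AE_loses by eventually_elim (auto simp: iff)
  qed
  moreover have "prob ?L \<le> prob ?B + (prob (?O Bin1) + prob (?O Bin2))"
  proof -
    have "prob ?L \<le> prob (?B \<union> (?O Bin1 \<union> ?O Bin2))"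
    proof (rule finite_measure_mono_AE)
      show "AE \<omega> in P. \<omega> \<in> ?L \<longrightarrow> \<omega> \<in> ?B \<union> (?O Bin1 \<union> ?O Bin2)"
        using AE_regular_path[of "(x, y)" f] AE_loses
      proof eventually_elim
        case (elim \<omega>)
        then obtain i where i: "loses i \<omega>" by blast
        show ?case
        proof
          assume "\<omega> \<in> ?L"
          then have "a \<le> load i (\<omega> m)" using iff[OF elim(1) i] by simp
          then have "(\<forall>j. a \<le> load j (\<omega> m)) \<or> load (other_bin i) (\<omega> m) < a"
            using bin_exhaust2[of _ i] by (metis not_le)
          then have "\<omega> \<in> ?B \<or> \<omega> \<in> ?O (other_bin i)" using i by simp
          then show "\<omega> \<in> ?B \<union> (?O Bin1 \<union> ?O Bin2)"
            by (cases i) (simp_all, blast+)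
        qed
      qed
    qed (intro sets.Un O events_loads_ge)
    also have "\<dots> \<le> prob ?B + prob (?O Bin1 \<union> ?O Bin2)"
      by (intro measure_Un_le sets.Un O events_loads_ge)
    also have "prob (?O Bin1 \<union> ?O Bin2) \<le> prob (?O Bin1) + prob (?O Bin2)"
      by (intro measure_Un_le O)
    finally show ?thesis by simp
  qed
  \<comment> \<open>The last load below the threshold is a' = a - 1, and then the other bin holds n
    - a' = \<open>Suc n - a\<close> balls, the upper index of \<open>S\<close>.\<close>
  moreover have ov: "prob (?O i) \<le> dens (x, y) * (2 * tail a / f a) / S\<^sup>2 * tail (Suc n - a)" for i
    using overtake_bound_loses[OF a(2), of m "x + y + m - a'" i] a(1,3)
    by (simp add: S_def n_def)
  moreover have "\<bar>prob ?B - 2 * l * S\<bar> \<le> 2 * e * S"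
    using prob_both_ge_approx[of a l e m] near a unfolding S_def n_def by simp
  ultimately show ?thesis
    using ov[of Bin1] ov[of Bin2] by linarith
qed

lemma loser_has_more_than_asymp:
  assumes l: "l > 0" "\<And>e. e > 0 \<Longrightarrow> \<exists>n. \<forall>a\<ge>n. \<forall>b\<ge>n. \<bar>dens (a, b) - l\<bar> < e"
    and \<alpha>: "0 < \<alpha>" "\<alpha> < 1 / 2"
  shows "(\<lambda>n. prob {\<omega>. loser_has_more_than \<alpha> n \<omega>}) \<sim>[sequentially]
    (\<lambda>n. 2 * l * S1 f (nat \<lceil>\<alpha> * real n\<rceil>) (n - nat \<lceil>\<alpha> * real n\<rceil>))"
proof -
  define a where "a n = nat \<lceil>\<alpha> * real n\<rceil>" for n
  define S where "S n = S1 f (a n) (n - a n)" for n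
  \<comment> \<open>This makes (2 + \<kappa>) \<alpha> = 1/2 + \<alpha> < 1, so n exceeds (2 +
    \<kappa>) \<alpha> n by n (1 - 2 \<alpha>) / 2, which is left for the rounding.\<close>
  define \<kappa> where "\<kappa> = (1 - 2 * \<alpha>) / (2 * \<alpha>)"
  have kappa: "\<kappa> > 0" using \<alpha> by (simp add: \<kappa>_def)
  have "filterlim (\<lambda>n. \<alpha> * real n) at_top sequentially"
    using \<alpha>(1) by (intro filterlim_tendsto_pos_mult_at_top[OF tendsto_const] filterlim_real_sequentially)
  then have a_top: "filterlim a at_top sequentially"
    unfolding filterlim_at_top
  proof (intro allI)
    fix Z assume "\<forall>Z. \<forall>\<^sub>F n in sequentially. Z \<le> \<alpha> * real n"
    then have "\<forall>\<^sub>F n in sequentially. real Z \<le> \<alpha> * real n" by blast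
    then show "\<forall>\<^sub>F n in sequentially. Z \<le> a n"
      by eventually_elim (simp add: a_def, linarith)
  qed
  have gap: "\<forall>\<^sub>F n in sequentially. real (n - a n) \<ge> (1 + \<kappa>) * real (a n)"
  proof -
    \<comment> \<open>Rounding up to \<open>a n\<close> costs at most 2 + \<kappa>, which from Z on
      fits into the spare n (1 - 2 \<alpha>) / 2.\<close>
    define Z where "Z = nat \<lceil>(2 + \<kappa>) / ((1 - 2 * \<alpha>) / 2)\<rceil>"
    show ?thesis
      using eventually_ge_at_top[of Z]
    proof eventually_elim
      case (elim n)
      have "(2 + \<kappa>) / ((1 - 2 * \<alpha>) / 2) \<le> real n" using elim by (simp add: Z_def)
      then have n: "2 + \<kappa> \<le> real n * ((1 - 2 * \<alpha>) / 2)"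
        using \<alpha> by (simp add: pos_divide_le_eq)
      have an: "real (a n) \<le> \<alpha> * real n + 1"
        using \<alpha>(1) unfolding a_def by (simp add: of_nat_nat)
      have "(2 + \<kappa>) * real (a n) \<le> (2 + \<kappa>) * (\<alpha> * real n + 1)"
        using an kappa by (intro mult_left_mono) auto
      also have "\<dots> = 2 * \<alpha> * real n + \<kappa> * \<alpha> * real n + (2 + \<kappa>)"
        by (simp add: algebra_simps)
      also have "\<kappa> * \<alpha> = (1 - 2 * \<alpha>) / 2"
        using \<alpha>(1) by (simp add: \<kappa>_def)
      also have "2 * \<alpha> * real n + (1 - 2 * \<alpha>) / 2 * real n + (2 + \<kappa>) \<le> real n"
        using n by (simp add: field_simps)
      finally have "(1 + \<kappa>) * real (a n) \<le> real n - real (a n)"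
        by (simp add: algebra_simps)
      then show ?case by linarith
    qed
  qed
  obtain C where C: "C > 0"
    "\<forall>\<^sub>F a in sequentially. \<forall>b. real b \<ge> (1 + \<kappa>) * real a \<longrightarrow> tail a \<le> C * S1 f a b"
    using tail_le_S1[OF kappa] by blast
  define D where "D = dens (x, y)"
  have D: "D \<ge> 0" unfolding D_def using dens_nonneg x_ge y_ge by simp
  have "(\<lambda>n. prob {\<omega>. loser_has_more_than \<alpha> n \<omega>} / S n) \<longlonglongrightarrow> 2 * l"
  proof (rule ratio_tendsto_of_relative_error)
    \<comment> \<open>The summands account for replacing T by S, for the fluctuation 2 e T \<le> 4 e
      S of the densities, and for overtaking by either bin.\<close>
    show "0 \<le> 2 * l + 4 + 4 * D * C\<^sup>2" using l(1) D by simp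
    fix e :: real assume e: "0 < e" "e < 1"
    obtain N where N: "\<And>a b. a \<ge> N \<Longrightarrow> b \<ge> N \<Longrightarrow> \<bar>dens (a, b) - l\<bar> \<le> e"
      using l(2)[OF e(1)] by (meson less_imp_le)
    obtain d :: nat where d: "\<forall>\<^sub>F a in sequentially. \<forall>b\<ge>a + d. 1 / f a \<le> e * S1 f a b"
      using inverse_le_S1[OF e(1)] .
    \<comment> \<open>N + 2 keeps a - 1 positive and the densities close to l; the condition on
      \<kappa> a makes the sum from a to n - a longer than d.\<close>
    have "\<forall>\<^sub>F a in sequentially. a \<ge> N + 2 \<and> \<kappa> * real a \<ge> real d + 1 \<and>
        (\<forall>b\<ge>a + d. 1 / f a \<le> e * S1 f a b) \<and>
        (\<forall>b. real b \<ge> (1 + \<kappa>) * real a \<longrightarrow> tail a \<le> C * S1 f a b)"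
    proof -
      have "\<forall>\<^sub>F a in sequentially. \<kappa> * real a \<ge> real d + 1"
        using filterlim_tendsto_pos_mult_at_top[OF tendsto_const kappa filterlim_real_sequentially]
        unfolding filterlim_at_top by blast
      then show ?thesis
        using eventually_ge_at_top[of "N + 2"] d C(2) by eventually_elim blast
    qed
    from eventually_compose_filterlim[OF this a_top] gap eventually_ge_at_top[of "x + y"]
    show "\<forall>\<^sub>F n in sequentially. S n > 0 \<and>
      \<bar>prob {\<omega>. loser_has_more_than \<alpha> n \<omega>} - 2 * l * S n\<bar> \<le> (2 * l + 4 + 4 * D * C\<^sup>2) * e * S n"
    proof eventually_elim
      case (elim n)
      let ?a = "a n" and ?b = "n - a n"
      \<comment> \<open>The probability produces the sum with upper end included, the claim the one
        without. They differ by 1 / f (n - a) \<le> 1 / f a \<le> e S.\<close>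
      define T where "T = S1 f ?a (Suc n - ?a)"
      define p where "p = prob {\<omega>. loser_has_more_than \<alpha> n \<omega>}"
      define E where "E = D * (2 * tail ?a / f ?a) / T\<^sup>2 * tail (Suc n - ?a)"
      from elim have aN: "?a \<ge> N + 2" and ka: "\<kappa> * real ?a \<ge> real d + 1"
        and inv: "?a + d \<le> ?b \<Longrightarrow> 1 / f ?a \<le> e * S n"
        and tl: "tail ?a \<le> C * S n"
        by (auto simp: S_def)
      have "real ?b \<ge> real ?a + (real d + 1)"
        using elim(2) ka by (simp add: distrib_right)
      then have ab: "?a + d + 1 \<le> ?b" by linarith
      have fa: "f ?a > 0" and fb: "f ?b > 0" using f_pos aN ab by auto
      have inv': "1 / f ?a \<le> e * S n" using inv ab by simp
      have "0 < e * S n" by (rule less_le_trans[OF _ inv']) (simp add: fa)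
      then have Spos: "S n > 0" using e(1) by (simp add: zero_less_mult_iff)
      have "T = S n + 1 / f ?b"
        unfolding T_def S_def S1_def using ab by (simp add: Suc_diff_le)
      moreover have "1 / f ?b \<le> 1 / f ?a"
        using fa f_mono[of ?a ?b] aN ab by (intro divide_left_mono) auto
      moreover have "0 < 1 / f ?b" using fb by simp
      moreover have "e * S n \<le> S n" using e(2) Spos by simp
      ultimately have T: "S n \<le> T" "T \<le> S n + e * S n" "T \<le> 2 * S n"
        using inv' by linarith+
      obtain m where m: "n = x + y + m" using elim(3) by (auto simp: le_iff_add)
      have "\<bar>p - 2 * l * T\<bar> \<le> 2 * e * T + 2 * E"
        unfolding p_def T_def E_def D_def
        by (rule loser_has_more_than_bounds[OF m a_def[of n], of "?a - 1"]) (use N aN ab in auto)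
      \<comment> \<open>Since \<alpha> < 1/2, the quotient of \<open>tail\<close> by T is at most C.
        The remaining factor 1 / f a is at most e S.\<close>
      moreover have "E \<le> 2 * D * C\<^sup>2 * (e * S n)"
      proof -
        have tpos: "tail ?a > 0" using aN by (intro tail_pos) simp
        have "tail (Suc n - ?a) \<le> tail ?a"
          using aN ab by (intro tail_antimono) auto
        then have "E \<le> D * (2 * tail ?a / f ?a) / T\<^sup>2 * tail ?a"
          unfolding E_def using D tpos fa by (intro mult_left_mono) auto
        also have "\<dots> = 2 * D * (tail ?a / T)\<^sup>2 * (1 / f ?a)"
          by (simp add: power2_eq_square mult_ac)
        also have "\<dots> \<le> 2 * D * C\<^sup>2 * (e * S n)"
        proof (rule mult_mono)
          have "tail ?a \<le> C * T"
            using tl T(1) C(1) by (meson mult_left_mono less_imp_le order_trans)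
          then have "tail ?a / T \<le> C"
            using T(1) Spos by (simp add: pos_divide_le_eq)
          then have "(tail ?a / T)\<^sup>2 \<le> C\<^sup>2"
            using tpos T(1) Spos by (intro power_mono) auto
          then show "2 * D * (tail ?a / T)\<^sup>2 \<le> 2 * D * C\<^sup>2"
            using D by (intro mult_left_mono) auto
        qed (use inv' D fa in auto)
        finally show ?thesis .
      qed
      moreover have "2 * e * T \<le> 2 * e * (2 * S n)"
        using T(3) e(1) by (intro mult_left_mono) auto
      moreover have "\<bar>2 * l * T - 2 * l * S n\<bar> \<le> 2 * l * (e * S n)"
      proof -
        have "\<bar>2 * l * T - 2 * l * S n\<bar> = 2 * l * (T - S n)"
          using l(1) T(1) by (simp add: right_diff_distrib[symmetric] abs_mult)
        also have "\<dots> \<le> 2 * l * (e * S n)"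
          using T(2) l(1) by (intro mult_left_mono) auto
        finally show ?thesis .
      qed
      ultimately have "\<bar>p - 2 * l * S n\<bar> \<le> 2 * l * (e * S n) + (2 * e * (2 * S n) + 2 * (2 * D * C\<^sup>2 * (e * S n)))"
        by linarith
      also have "\<dots> = (2 * l + 4 + 4 * D * C\<^sup>2) * e * S n"
        by (simp add: algebra_simps)
      finally show ?case using Spos by (simp add: p_def)
    qed
  qed
  then show ?thesis
    using l(1) unfolding S_def a_def by (intro asymp_equiv_of_ratio) auto
qed

end

theorem theorem5:
  fixes f :: "nat \<Rightarrow> real"
  assumes "valid_feedback f"
  shows "summable (\<lambda>j. 1 / f (Suc j)) \<and>
    (\<forall>x\<ge>1. \<forall>y\<ge>1. \<exists>c>0.
       (\<forall>\<alpha>. 0 < \<alpha> \<and> \<alpha> < 1 / 2 \<longrightarrow>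
          (\<lambda>n. \<P>(\<omega> in bins_process f (x, y). loser_has_more_than \<alpha> n \<omega>))
            \<sim>[sequentially]
          (\<lambda>n. c * S1 f (nat \<lceil>\<alpha> * real n\<rceil>) (n - nat \<lceil>\<alpha> * real n\<rceil>))) \<and>
       (\<lambda>n. \<P>(\<omega> in bins_process f (x, y). losing_number \<omega> > n))
         \<sim>[sequentially]
       (\<lambda>n. c * (\<Sum>j. 1 / f (n + j))))"
proof (intro conjI allI impI)
  obtain \<eta> where "tame_feedback f \<eta>" using valid_feedback_tame[OF assms] .
  then interpret tame_feedback f \<eta> .
  show "summable (\<lambda>j. 1 / f (Suc j))"
    using summable_inverse[of 1] by simp
  fix x y :: nat assume xy: "x \<ge> 1" "y \<ge> 1"
  interpret bins_chain f \<eta> x y by unfold_locales (use xy in auto)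
  obtain l where l: "l > 0" "\<And>e. e > 0 \<Longrightarrow> \<exists>n. \<forall>a\<ge>n. \<forall>b\<ge>n. \<bar>dens (a, b) - l\<bar> < e"
    using dens_limit by blast
  show "\<exists>c>0.
       (\<forall>\<alpha>. 0 < \<alpha> \<and> \<alpha> < 1 / 2 \<longrightarrow>
          (\<lambda>n. \<P>(\<omega> in bins_process f (x, y). loser_has_more_than \<alpha> n \<omega>))
            \<sim>[sequentially]
          (\<lambda>n. c * S1 f (nat \<lceil>\<alpha> * real n\<rceil>) (n - nat \<lceil>\<alpha> * real n\<rceil>))) \<and>
       (\<lambda>n. \<P>(\<omega> in bins_process f (x, y). losing_number \<omega> > n))
         \<sim>[sequentially]
       (\<lambda>n. c * (\<Sum>j. 1 / f (n + j)))"
    \<comment> \<open>The same limit l governs both probabilities and is obtained before \<alpha> is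
      fixed, so c = 2 l serves throughout.\<close>
    using l(1) loser_has_more_than_asymp[OF l] losing_number_asymp[OF l]
    by (intro exI[of _ "2 * l"]) (simp add: space_bins_process tail_def)
qed

end
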